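(* Every Lauritzen manifold can be integrated by a globally defined contrast bi-form. That is, for every smooth manifold $M$ with a pseudo-Riemannian metric $g$ and an affine connection $\nabla$, there exists a contrast bi-form $\varpi$ defined on all of $M\times M$ such that $g^\varpi=g$ and $\nabla^\varpi=\nabla$.
   Context: A Lauritzen (metric-affine) manifold is a triple $(M,g,\nabla)$ with $M$ a smooth manifold, $g$ a pseudo-Riemannian metric and $\nabla$ an affine connection. Let $\pi_L,\pi_R\colon M\times M\to M$ be the left and right projections and $\iota\colon M\to M\times M$, $\iota(m)=(m,m)$. A $(1,1)$-bi-form is a smooth section of $\pi_L^*T^*M\otimes\pi_R^*T^*M\to M\times M$ (globally defined), or such a section over an open neighbourhood of the diagonal (local). For vector fields, $\varpi(X\mid Y)(m,n)=\varpi_{(m,n)}(X_m\mid Y_n)$. For $Z\in\mathfrak X(M)$, $Z^L_{(m,n)}=(Z_m,0)$ is the left lift to $M\times M$. A $(1,1)$-bi-form $\varpi$ is a contrast bi-form if $g^\varpi(X,Y)=\iota^*(\varpi(X\mid Y))$ is a pseudo-Riemannian metric on $M$; it then induces an affine connection $\nabla^\varpi$ by $g^\varpi(\nabla^\varpi_ZX,Y)=\iota^*\left(\mathcal L_{Z^L}(\varpi(X\mid Y))\right)$ for all $X,Y,Z\in\mathfrak X(M)$. One says $\varpi$ integrates $(M,g,\nabla)$ if $g^\varpi=g$ and $\nabla^\varpi=\nabla$. *)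

theory Defs
  imports "HOL-Analysis.Analysis"
begin

section \<open>Smooth maps between normed spaces\<close>

text \<open>
  On an open subset of a finite-dimensional space this is the usual notion of a \<open>C\<^sup>k\<close> map: the map
  is differentiable and all its directional derivatives are \<open>C\<^sup>k\<^sup>-\<^sup>1\<close>. It is only used for open \<open>S\<close>.
\<close>

primrec Ck_on :: "nat \<Rightarrow> 'a::real_normed_vector set \<Rightarrow> ('a \<Rightarrow> 'b::real_normed_vector) \<Rightarrow> bool"
where
  "Ck_on 0 S f \<longleftrightarrow> continuous_on S f"
| "Ck_on (Suc k) S f \<longleftrightarrow> (\<forall>x\<in>S. f differentiable (at x)) \<and>
     (\<forall>v. Ck_on k S (\<lambda>x. frechet_derivative f (at x) v))"

definition smooth_on :: "'a::real_normed_vector set \<Rightarrow> ('a \<Rightarrow> 'b::real_normed_vector) \<Rightarrow> bool" where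
  "smooth_on S f \<longleftrightarrow> (\<forall>k. Ck_on k S f)"


section \<open>Smooth manifolds\<close>

text \<open>
  The points of the manifold are the elements of a Hausdorff, second countable type. A chart is a
  pair \<open>(U, \<phi>)\<close> of a domain and a coordinate map, of which only the values on \<open>U\<close> matter.
  The smooth structure is given by an atlas, which need not be maximal.

  The model space is a finite-dimensional inner product space. The class \<open>euclidean_space\<close> is not
  used for it because it forces the dimension to be positive.
\<close>

type_synonym ('m, 'e) chart = "'m set \<times> ('m \<Rightarrow> 'e)"

definition chart_inv :: "('m, 'e) chart \<Rightarrow> 'e \<Rightarrow> 'm" where
  "chart_inv c = inv_into (fst c) (snd c)"

definition smooth_manifold ::
  "('m::{t2_space, second_countable_topology}, 'e::real_inner) chart set \<Rightarrow> bool"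
where
  "smooth_manifold A \<longleftrightarrow>
     (\<exists>B::'e set. finite B \<and> span B = UNIV) \<and>
     (\<Union>(U, \<phi>)\<in>A. U) = UNIV \<and>
     (\<forall>(U, \<phi>)\<in>A. open U \<and> open (\<phi> ` U) \<and> homeomorphism U (\<phi> ` U) \<phi> (chart_inv (U, \<phi>))) \<and>
     (\<forall>(U, \<phi>)\<in>A. \<forall>(V, \<psi>)\<in>A. smooth_on (\<phi> ` (U \<inter> V)) (\<psi> \<circ> chart_inv (U, \<phi>)))"

definition prod_atlas ::
  "('m, 'e) chart set \<Rightarrow> ('n, 'f) chart set \<Rightarrow> ('m \<times> 'n, 'e \<times> 'f) chart set"
where
  "prod_atlas A A' = {(U \<times> V, map_prod \<phi> \<psi>) | U \<phi> V \<psi>. (U, \<phi>) \<in> A \<and> (V, \<psi>) \<in> A'}"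

definition smooth_functions :: "('m, 'e::real_normed_vector) chart set \<Rightarrow> ('m \<Rightarrow> real) set" where
  "smooth_functions A = {f. \<forall>(U, \<phi>)\<in>A. smooth_on (\<phi> ` U) (f \<circ> chart_inv (U, \<phi>))}"


section \<open>Tangent vectors and vector fields\<close>

text \<open>
  A tangent vector at \<open>p\<close> is a derivation at \<open>p\<close> of the algebra of smooth functions. Tangent vectors
  are total functions on \<open>'m \<Rightarrow> real\<close>; the value 0 off the smooth functions makes
  equality of tangent vectors the intended one.
\<close>

type_synonym 'm tvec = "('m \<Rightarrow> real) \<Rightarrow> real"
type_synonym 'm vfield = "'m \<Rightarrow> 'm tvec"

definition tangent_space :: "('m, 'e::real_normed_vector) chart set \<Rightarrow> 'm \<Rightarrow> 'm tvec set" where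
  "tangent_space A p = {v.
     (\<forall>f\<in>smooth_functions A. \<forall>h\<in>smooth_functions A. \<forall>a b.
        v (\<lambda>x. a * f x + b * h x) = a * v f + b * v h) \<and>
     (\<forall>f\<in>smooth_functions A. \<forall>h\<in>smooth_functions A.
        v (\<lambda>x. f x * h x) = f p * v h + h p * v f) \<and>
     (\<forall>f. f \<notin> smooth_functions A \<longrightarrow> v f = 0)}"

text \<open>
  The coordinate tangent vector \<open>\<Sum>\<^sub>i u\<^sub>i \<partial>/\<partial>x\<^sub>i\<close> at \<open>p\<close> of a chart around \<open>p\<close>: the derivation taking the
  derivative of the coordinate expression in the direction \<open>u\<close>.
\<close>

definition coord_tangent ::
  "('m, 'e::real_normed_vector) chart set \<Rightarrow> ('m, 'e) chart \<Rightarrow> 'm \<Rightarrow> 'e \<Rightarrow> 'm tvec"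
where
  "coord_tangent A c p u = (\<lambda>f. if f \<in> smooth_functions A
     then frechet_derivative (f \<circ> chart_inv c) (at (snd c p)) u else 0)"

definition vector_fields :: "('m, 'e::real_normed_vector) chart set \<Rightarrow> 'm vfield set" where
  "vector_fields A = {X. (\<forall>p. X p \<in> tangent_space A p) \<and>
     (\<forall>f\<in>smooth_functions A. (\<lambda>p. X p f) \<in> smooth_functions A)}"

definition lie_derivative :: "'m vfield \<Rightarrow> ('m \<Rightarrow> real) \<Rightarrow> 'm \<Rightarrow> real" where
  "lie_derivative X f = (\<lambda>p. X p f)"

definition vf_add :: "'m vfield \<Rightarrow> 'm vfield \<Rightarrow> 'm vfield" where
  "vf_add X Y = (\<lambda>p h. X p h + Y p h)"

definition vf_scale :: "('m \<Rightarrow> real) \<Rightarrow> 'm vfield \<Rightarrow> 'm vfield" where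
  "vf_scale f X = (\<lambda>p h. f p * X p h)"


section \<open>Lauritzen manifolds\<close>

definition bilinear_between :: "'m tvec set \<Rightarrow> 'n tvec set \<Rightarrow> ('m tvec \<Rightarrow> 'n tvec \<Rightarrow> real) \<Rightarrow> bool"
where
  "bilinear_between V W \<beta> \<longleftrightarrow>
     (\<forall>v\<in>V. \<forall>v'\<in>V. \<forall>w\<in>W. \<forall>a b. \<beta> (\<lambda>f. a * v f + b * v' f) w = a * \<beta> v w + b * \<beta> v' w) \<and>
     (\<forall>v\<in>V. \<forall>w\<in>W. \<forall>w'\<in>W. \<forall>a b. \<beta> v (\<lambda>f. a * w f + b * w' f) = a * \<beta> v w + b * \<beta> v w')"

text \<open>
  Smoothness of a section of a tensor bundle means smoothness of its components in the coordinate
  frames of the charts. The metric need not have constant signature if the manifold is disconnected.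
\<close>

definition pseudo_riemannian_metric ::
  "('m, 'e::real_normed_vector) chart set \<Rightarrow> ('m \<Rightarrow> 'm tvec \<Rightarrow> 'm tvec \<Rightarrow> real) \<Rightarrow> bool"
where
  "pseudo_riemannian_metric A g \<longleftrightarrow>
     (\<forall>p. bilinear_between (tangent_space A p) (tangent_space A p) (g p)) \<and>
     (\<forall>p. \<forall>v\<in>tangent_space A p. \<forall>w\<in>tangent_space A p. g p v w = g p w v) \<and>
     (\<forall>p. \<forall>v\<in>tangent_space A p. (\<forall>w\<in>tangent_space A p. g p v w = 0) \<longrightarrow> v = (\<lambda>f. 0)) \<and>
     (\<forall>(U, \<phi>)\<in>A. \<forall>u u'. smooth_on (\<phi> ` U)
        (\<lambda>x. let p = chart_inv (U, \<phi>) x in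
           g p (coord_tangent A (U, \<phi>) p u) (coord_tangent A (U, \<phi>) p u')))"

text \<open>\<open>D X Y\<close> is the covariant derivative of \<open>Y\<close> in the direction \<open>X\<close>.\<close>

definition affine_connection ::
  "('m, 'e::real_normed_vector) chart set \<Rightarrow> ('m vfield \<Rightarrow> 'm vfield \<Rightarrow> 'm vfield) \<Rightarrow> bool"
where
  "affine_connection A D \<longleftrightarrow>
     (\<forall>X\<in>vector_fields A. \<forall>Y\<in>vector_fields A. D X Y \<in> vector_fields A) \<and>
     (\<forall>X\<in>vector_fields A. \<forall>X'\<in>vector_fields A. \<forall>Y\<in>vector_fields A.
        D (vf_add X X') Y = vf_add (D X Y) (D X' Y)) \<and>
     (\<forall>f\<in>smooth_functions A. \<forall>X\<in>vector_fields A. \<forall>Y\<in>vector_fields A.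
        D (vf_scale f X) Y = vf_scale f (D X Y)) \<and>
     (\<forall>X\<in>vector_fields A. \<forall>Y\<in>vector_fields A. \<forall>Y'\<in>vector_fields A.
        D X (vf_add Y Y') = vf_add (D X Y) (D X Y')) \<and>
     (\<forall>f\<in>smooth_functions A. \<forall>X\<in>vector_fields A. \<forall>Y\<in>vector_fields A.
        D X (vf_scale f Y) = vf_add (vf_scale (lie_derivative X f) Y) (vf_scale f (D X Y)))"

definition lauritzen_manifold ::
  "('m::{t2_space, second_countable_topology}, 'e::real_inner) chart set \<Rightarrow>
   ('m \<Rightarrow> 'm tvec \<Rightarrow> 'm tvec \<Rightarrow> real) \<Rightarrow> ('m vfield \<Rightarrow> 'm vfield \<Rightarrow> 'm vfield) \<Rightarrow> bool"
where
  "lauritzen_manifold A g D \<longleftrightarrow>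
     smooth_manifold A \<and> pseudo_riemannian_metric A g \<and> affine_connection A D"


section \<open>Contrast bi-forms\<close>

text \<open>
  Globally defined (1,1)-bi-forms: the fibre over \<open>(m, n)\<close> of the tensor product of the two
  pulled back cotangent bundles consists of the bilinear forms on \<open>T\<^sub>m M \<times> T\<^sub>n M\<close>.
\<close>

type_synonym 'm biform = "'m \<times> 'm \<Rightarrow> 'm tvec \<Rightarrow> 'm tvec \<Rightarrow> real"

definition global_biform :: "('m, 'e::real_normed_vector) chart set \<Rightarrow> 'm biform \<Rightarrow> bool" where
  "global_biform A \<omega> \<longleftrightarrow>
     (\<forall>m n. bilinear_between (tangent_space A m) (tangent_space A n) (\<omega> (m, n))) \<and>
     (\<forall>(U, \<phi>)\<in>A. \<forall>(V, \<psi>)\<in>A. \<forall>u v. smooth_on (\<phi> ` U \<times> \<psi> ` V)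
        (\<lambda>(x, y). let m = chart_inv (U, \<phi>) x; n = chart_inv (V, \<psi>) y in
           \<omega> (m, n) (coord_tangent A (U, \<phi>) m u) (coord_tangent A (V, \<psi>) n v)))"

definition biform_apply :: "'m biform \<Rightarrow> 'm vfield \<Rightarrow> 'm vfield \<Rightarrow> 'm \<times> 'm \<Rightarrow> real" where
  "biform_apply \<omega> X Y = (\<lambda>(m, n). \<omega> (m, n) (X m) (Y n))"

definition diag_pullback :: "('m \<times> 'm \<Rightarrow> real) \<Rightarrow> 'm \<Rightarrow> real" where
  "diag_pullback F = (\<lambda>m. F (m, m))"

text \<open>
  The left lift \<open>(Z\<^sub>m, 0)\<close> as a derivation at \<open>(m, n)\<close> on the product manifold: it is the
  image of \<open>Z\<^sub>m\<close> under the differential of the inclusion \<open>x \<mapsto> (x, n)\<close>.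
\<close>

definition left_lift ::
  "('m, 'e::real_normed_vector) chart set \<Rightarrow> 'm vfield \<Rightarrow> ('m \<times> 'm) vfield"
where
  "left_lift A Z = (\<lambda>(m, n) F. if F \<in> smooth_functions (prod_atlas A A)
     then Z m (\<lambda>x. F (x, n)) else 0)"

text \<open>
  Pointwise form of the metric, so that
  \<open>induced_metric \<omega> m (X m) (Y m) = diag_pullback (biform_apply \<omega> X Y) m\<close> for all vector fields.
\<close>

definition induced_metric :: "'m biform \<Rightarrow> 'm \<Rightarrow> 'm tvec \<Rightarrow> 'm tvec \<Rightarrow> real" where
  "induced_metric \<omega> = (\<lambda>m. \<omega> (m, m))"

definition contrast_biform :: "('m, 'e::real_normed_vector) chart set \<Rightarrow> 'm biform \<Rightarrow> bool" where
  "contrast_biform A \<omega> \<longleftrightarrow>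
     global_biform A \<omega> \<and> pseudo_riemannian_metric A (induced_metric \<omega>)"

definition induced_connection ::
  "('m, 'e::real_normed_vector) chart set \<Rightarrow> 'm biform \<Rightarrow> 'm vfield \<Rightarrow> 'm vfield \<Rightarrow> 'm vfield"
where
  "induced_connection A \<omega> Z X = (THE W. W \<in> vector_fields A \<and>
     (\<forall>Y\<in>vector_fields A. (\<lambda>m. induced_metric \<omega> m (W m) (Y m)) =
        diag_pullback (lie_derivative (left_lift A Z) (biform_apply \<omega> X Y))))"

text \<open>
  Metrics and connections are total functions in the logic; they are compared on tangent vectors and
  on smooth vector fields only.
\<close>

definition integrates ::
  "('m, 'e::real_normed_vector) chart set \<Rightarrow> 'm biform \<Rightarrow>
   ('m \<Rightarrow> 'm tvec \<Rightarrow> 'm tvec \<Rightarrow> real) \<Rightarrow> ('m vfield \<Rightarrow> 'm vfield \<Rightarrow> 'm vfield) \<Rightarrow> bool"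
where
  "integrates A \<omega> g D \<longleftrightarrow>
     (\<forall>m. \<forall>v\<in>tangent_space A m. \<forall>w\<in>tangent_space A m. induced_metric \<omega> m v w = g m v w) \<and>
     (\<forall>Z\<in>vector_fields A. \<forall>X\<in>vector_fields A. induced_connection A \<omega> Z X = D Z X)"

end

theory Submission
  imports Defs
begin

text \<open>
  There are smooth functions \<open>F\<^sub>k\<close> and a locally finite family of vector fields \<open>W\<^sub>k\<close> such that
  \<open>v = \<Sum>\<^sub>k v(F\<^sub>k) W\<^sub>k\<close> for every tangent vector \<open>v\<close>: cut off the coordinate functions and coordinate
  fields of countably many charts by a partition of unity. Then
    \<open>\<omega>(m,n)(v | w) = \<Sum>\<^sub>k v(F\<^sub>k) g\<^sub>n(W\<^sub>k + \<Sum>\<^sub>l (F\<^sub>l(m) - F\<^sub>l(n)) D(W\<^sub>l, W\<^sub>k), w)\<close>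
  is a global bi-form with \<open>g\<close> on the diagonal, and its left derivative along the diagonal is
    \<open>\<Sum>\<^sub>k g(Z(X F\<^sub>k) W\<^sub>k + X(F\<^sub>k) D(\<Sum>\<^sub>l Z(F\<^sub>l) W\<^sub>l, W\<^sub>k), Y) = g(D(Z, X), Y)\<close>
  by the Leibniz rule applied to \<open>X = \<Sum>\<^sub>k X(F\<^sub>k) W\<^sub>k\<close>.
\<close>

section \<open>Calculus of smooth maps\<close>

text \<open>The terms \<open>v(F\<^sub>k) g\<^sub>n(W\<^sub>k, w)\<close> alone already restrict to
  \<open>g\<close>, but they induce the connection
  \<open>\<Sum>\<^sub>k Z(X F\<^sub>k) W\<^sub>k\<close>, which misses \<open>D(Z, X)\<close> by
  \<open>\<Sum>\<^sub>k X(F\<^sub>k) D(Z, W\<^sub>k)\<close>. This defect is tensorial in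
  \<open>X\<close> and in \<open>Z\<close>, so it can be supplied by coefficients that vanish on the
  diagonal and have the right first derivative there. The differences
  \<open>F\<^sub>l(m) - F\<^sub>l(n)\<close> do this: their left derivatives
  \<open>Z(F\<^sub>l)\<close> are the coefficients of \<open>Z\<close> in the frame. The obstacle to
  a global form is that coordinate differences make sense in one chart only and that tangent spaces
  at distant points have no natural identification. None is used here: the left slot enters through
  the numbers \<open>v(F\<^sub>k)\<close>, the right slot through fields evaluated at
  \<open>n\<close>. The price is an overcomplete frame: the \<open>W\<^sub>k\<close> are dependent
  in general, and only the expansion formula is available. Local finiteness is a condition on the
  \<open>W\<^sub>k\<close>, hence on \<open>n\<close>, so the index set stays fixed while
  \<open>m\<close> moves, in particular during the left derivative.\<close>

lemma frechet_derivative_cong_open: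
  assumes "open S" "x \<in> S" "\<And>y. y \<in> S \<Longrightarrow> f y = g y"
  shows "frechet_derivative f (at x) = frechet_derivative g (at x)"
proof -
  have "(f has_derivative D) (at x) \<longleftrightarrow> (g has_derivative D) (at x)" for D
    using assms by (metis has_derivative_transform_within_open)
  then show ?thesis by (simp add: frechet_derivative_def)
qed

lemma differentiable_cong_open:
  assumes "open S" "x \<in> S" "\<And>y. y \<in> S \<Longrightarrow> f y = g y" "f differentiable (at x)"
  shows "g differentiable (at x)"
  using assms unfolding differentiable_def by (metis has_derivative_transform_within_open)

lemma frechet_derivative_eqI:
  "(f has_derivative D) (at x) \<Longrightarrow> frechet_derivative f (at x) = D"
  by (metis frechet_derivative_at)

lemma Ck_on_cong:
  assumes "open S" "\<And>x. x \<in> S \<Longrightarrow> f x = g x" "Ck_on k S f"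
  shows "Ck_on k S g"
  using assms(2,3)
proof (induction k arbitrary: f g)
  case 0
  then show ?case by (simp cong: continuous_on_cong)
next
  case (Suc k)
  have "frechet_derivative f (at x) v = frechet_derivative g (at x) v" if "x \<in> S" for x v
    using frechet_derivative_cong_open[OF assms(1) that Suc.prems(1)] by simp
  moreover have "Ck_on k S (\<lambda>x. frechet_derivative f (at x) v)" for v
    using Suc.prems(2) by simp
  ultimately have "Ck_on k S (\<lambda>x. frechet_derivative g (at x) v)" for v
    by (rule Suc.IH)
  moreover have "g differentiable (at x)" if "x \<in> S" for x
    by (rule differentiable_cong_open[OF assms(1) that Suc.prems(1)]) (use Suc.prems(2) that in auto)
  ultimately show ?case by simp
qed

lemma smooth_on_cong:
  "open S \<Longrightarrow> (\<And>x. x \<in> S \<Longrightarrow> f x = g x) \<Longrightarrow> smooth_on S f \<Longrightarrow> smooth_on S g"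
  unfolding smooth_on_def by (metis Ck_on_cong)

lemma Ck_on_subset: "Ck_on k S f \<Longrightarrow> T \<subseteq> S \<Longrightarrow> Ck_on k T f"
  by (induction k arbitrary: f) (auto intro: continuous_on_subset)

lemma smooth_on_subset: "smooth_on S f \<Longrightarrow> T \<subseteq> S \<Longrightarrow> smooth_on T f"
  unfolding smooth_on_def by (metis Ck_on_subset)

lemma Ck_on_local:
  assumes "\<And>x. x \<in> S \<Longrightarrow> \<exists>T. open T \<and> x \<in> T \<and> Ck_on k T f"
  shows "Ck_on k S f"
  using assms
proof (induction k arbitrary: f)
  case 0
  then show ?case
    unfolding Ck_on.simps
    by (meson continuous_at_imp_continuous_on continuous_on_eq_continuous_at)
next
  case (Suc k)
  have "Ck_on k S (\<lambda>x. frechet_derivative f (at x) v)" for v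
    by (rule Suc.IH) (use Suc.prems in \<open>unfold Ck_on.simps, meson\<close>)
  then show ?case using Suc.prems unfolding Ck_on.simps by meson
qed

lemma smooth_on_local:
  assumes "\<And>x. x \<in> S \<Longrightarrow> \<exists>T. open T \<and> x \<in> T \<and> smooth_on T f"
  shows "smooth_on S f"
  using assms unfolding smooth_on_def by (meson Ck_on_local)

lemma Ck_on_SucD: "Ck_on (Suc k) S f \<Longrightarrow> Ck_on k S f"
proof (induction k arbitrary: f)
  case 0
  then show ?case
    by (auto intro!: continuous_at_imp_continuous_on differentiable_imp_continuous_within)
next
  case (Suc k)
  then show ?case by (simp only: Ck_on.simps) blast
qed

lemma Ck_on_Suc_has_derivative:
  "Ck_on (Suc k) S f \<Longrightarrow> x \<in> S \<Longrightarrow> (f has_derivative frechet_derivative f (at x)) (at x)"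
  by (simp add: frechet_derivative_works)

lemma Ck_on_Suc_frechet_derivative:
  "Ck_on (Suc k) S f \<Longrightarrow> Ck_on k S (\<lambda>x. frechet_derivative f (at x) v)"
  by simp

lemma smooth_on_differentiable: "smooth_on S f \<Longrightarrow> x \<in> S \<Longrightarrow> f differentiable (at x)"
  unfolding smooth_on_def by (metis Ck_on.simps(2))

lemma smooth_on_has_derivative:
  "smooth_on S f \<Longrightarrow> x \<in> S \<Longrightarrow> (f has_derivative frechet_derivative f (at x)) (at x)"
  using smooth_on_differentiable frechet_derivative_works by blast

lemma smooth_on_frechet_derivative:
  "smooth_on S f \<Longrightarrow> smooth_on S (\<lambda>x. frechet_derivative f (at x) v)"
  unfolding smooth_on_def by (metis Ck_on.simps(2))

lemma smooth_on_continuous_on: "smooth_on S f \<Longrightarrow> continuous_on S f"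
  unfolding smooth_on_def by (metis Ck_on.simps(1))

text \<open>Any formula \<open>F\<close> for the derivative may stand in for
  \<open>frechet_derivative\<close>: on an open set the two agree at every point, and
  \<open>Ck_on_cong\<close> carries the regularity over. The inductive closure proofs below use it
  to apply the usual differentiation rules.\<close>

lemma Ck_on_SucI:
  assumes "open S" "\<And>x. x \<in> S \<Longrightarrow> (f has_derivative F x) (at x)" "\<And>v. Ck_on k S (\<lambda>x. F x v)"
  shows "Ck_on (Suc k) S f"
proof -
  have *: "F x v = frechet_derivative f (at x) v" if "x \<in> S" for x v
    using frechet_derivative_eqI[OF assms(2)[OF that]] by simp
  have "Ck_on k S (\<lambda>x. frechet_derivative f (at x) v)" for v
    by (rule Ck_on_cong[OF assms(1) *]) (use assms(3) in auto)
  then show ?thesis using assms(2) by (auto simp: differentiable_def)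
qed

lemma Ck_on_const: "open S \<Longrightarrow> Ck_on k S (\<lambda>x. c)"
proof (induction k arbitrary: c)
  case (Suc k)
  then show ?case by (intro Ck_on_SucI[where F="\<lambda>x v. 0"]) auto
qed auto

lemma Ck_on_linear: "open S \<Longrightarrow> bounded_linear L \<Longrightarrow> Ck_on k S L"
proof (cases k)
  case (Suc k)
  assume "open S" "bounded_linear L"
  then have "Ck_on (Suc k) S L"
    by (intro Ck_on_SucI[where F="\<lambda>x. L"] Ck_on_const) (auto intro: bounded_linear_imp_has_derivative)
  then show ?thesis using Suc by simp
qed (auto intro: linear_continuous_on)

lemma Ck_on_add:
  "open S \<Longrightarrow> Ck_on k S f \<Longrightarrow> Ck_on k S g \<Longrightarrow> Ck_on k S (\<lambda>x. f x + g x)"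
proof (induction k arbitrary: f g)
  case (Suc k)
  show ?case
    by (rule Ck_on_SucI[where F="\<lambda>x v. frechet_derivative f (at x) v + frechet_derivative g (at x) v"])
      (intro has_derivative_add Suc.IH Suc.prems Ck_on_Suc_has_derivative[OF Suc.prems(2)]
        Ck_on_Suc_has_derivative[OF Suc.prems(3)] Ck_on_Suc_frechet_derivative | assumption)+
qed (auto intro: continuous_intros)

lemma Ck_on_bilinear:
  assumes "bounded_bilinear m" "open S"
  shows "Ck_on k S f \<Longrightarrow> Ck_on k S g \<Longrightarrow> Ck_on k S (\<lambda>x. m (f x) (g x))"
proof (induction k arbitrary: f g)
  case 0
  then show ?case using bounded_bilinear.continuous_on[OF assms(1)] by simp
next
  case (Suc k)
  show ?case
  proof (rule Ck_on_SucI[where F="\<lambda>x v. m (f x) (frechet_derivative g (at x) v) + m (frechet_derivative f (at x) v) (g x)"])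
    show "((\<lambda>x. m (f x) (g x)) has_derivative
        (\<lambda>v. m (f x) (frechet_derivative g (at x) v) + m (frechet_derivative f (at x) v) (g x))) (at x)"
      if "x \<in> S" for x
      by (rule bounded_bilinear.FDERIV[OF assms(1)])
        (rule Ck_on_Suc_has_derivative Suc.prems that)+
  next
    fix v
    have "Ck_on k S f" "Ck_on k S g" using Suc.prems Ck_on_SucD by blast+
    then show "Ck_on k S (\<lambda>x. m (f x) (frechet_derivative g (at x) v) + m (frechet_derivative f (at x) v) (g x))"
      by (intro Ck_on_add[OF assms(2)] Suc.IH Ck_on_Suc_frechet_derivative Suc.prems)
  qed (fact assms)
qed

lemma Ck_on_linear_compose:
  assumes "open S" "bounded_linear L"
  shows "Ck_on k S f \<Longrightarrow> Ck_on k S (\<lambda>x. L (f x))"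
proof (induction k arbitrary: f)
  case 0
  then show ?case using assms by (simp add: bounded_linear.continuous_on)
next
  case (Suc k)
  show ?case
    by (rule Ck_on_SucI[where F="\<lambda>x v. L (frechet_derivative f (at x) v)"])
      (intro assms bounded_linear.has_derivative[OF assms(2)] Suc.IH Suc.prems
        Ck_on_Suc_has_derivative[OF Suc.prems] Ck_on_Suc_frechet_derivative | assumption)+
qed

lemma Ck_on_sum:
  "open S \<Longrightarrow> (\<And>i. i \<in> I \<Longrightarrow> Ck_on k S (f i)) \<Longrightarrow> Ck_on k S (\<lambda>x. \<Sum>i\<in>I. f i x)"
  by (induction I rule: infinite_finite_induct) (auto intro: Ck_on_const Ck_on_add)

text \<open>Orthonormality is not needed: any finite family with this expansion property (a Parseval frame)
  serves as a basis. This also covers the zero-dimensional model space.\<close>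

definition expansion_basis :: "'a::real_inner set \<Rightarrow> bool" where
  "expansion_basis B \<longleftrightarrow> finite B \<and> (\<forall>x. (\<Sum>b\<in>B. (x \<bullet> b) *\<^sub>R b) = x)"

lemma expansion_basis_real: "expansion_basis {1::real}"
  by (simp add: expansion_basis_def)

text \<open>Gram-Schmidt gives a finite orthogonal spanning set; dropping the zero vector and
  normalising the rest yields the expansion.\<close>

lemma expansion_basis_exists:
  fixes C :: "'a::real_inner set"
  assumes "finite C" "span C = UNIV"
  shows "\<exists>B::'a set. expansion_basis B"
proof -
  obtain B where "finite B" "card B \<le> card C" "span B = span C" "pairwise orthogonal B"
    using basis_orthogonal[OF assms(1)] by auto
  then have B: "finite B" "span B = UNIV" "pairwise orthogonal B"
    using assms(2) by simp_all
  define N where "N = (\<lambda>b. b /\<^sub>R norm b) ` (B - {0})"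
  \<comment> \<open>Distinct elements of \<open>B - {0}\<close> are orthogonal, so normalising
    cannot identify them. Otherwise terms would merge when the sum over \<open>N\<close> is
    rewritten as a sum over \<open>B - {0}\<close>.\<close>
  have inj: "inj_on (\<lambda>b. b /\<^sub>R norm b) (B - {0})"
  proof (rule inj_onI, rule ccontr)
    fix x y assume *: "x \<in> B - {0}" "y \<in> B - {0}" "x /\<^sub>R norm x = y /\<^sub>R norm y" "x \<noteq> y"
    then have "x \<bullet> y = 0" using B(3) by (auto simp: pairwise_def orthogonal_def)
    then have "(x /\<^sub>R norm x) \<bullet> (y /\<^sub>R norm y) = 0" by simp
    moreover have "(x /\<^sub>R norm x) \<bullet> (x /\<^sub>R norm x) = 1"
      using *(1) by (simp add: dot_square_norm power2_eq_square)
    ultimately show False using *(3) by simp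
  qed
  have "(\<Sum>b\<in>N. (x \<bullet> b) *\<^sub>R b) = x" for x
  proof -
    \<comment> \<open>Both sides are linear in \<open>x\<close>, so induction over the span reduces
      the claim to a single element \<open>y\<close> of \<open>B\<close>, where only the summand
      \<open>b = y\<close> survives.\<close>
    have "x \<in> span B" using B by auto
    then have "(\<Sum>b\<in>B-{0}. (x \<bullet> (b /\<^sub>R norm b)) *\<^sub>R (b /\<^sub>R norm b)) = x"
    proof (induction rule: span_induct_alt)
      case base
      then show ?case by simp
    next
      case (step c y z)
      have "(\<Sum>b\<in>B-{0}. (y \<bullet> (b /\<^sub>R norm b)) *\<^sub>R (b /\<^sub>R norm b)) = y"
      proof (cases "y = 0")
        case False
        have "(y \<bullet> (b /\<^sub>R norm b)) *\<^sub>R (b /\<^sub>R norm b) = (if b = y then y else 0)"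
          if "b \<in> B - {0}" for b
        proof (cases "b = y")
          case True
          have "(y \<bullet> y) / (norm y * norm y) = 1"
            using False by (simp add: dot_square_norm power2_eq_square)
          then have "inverse (norm y) * (y \<bullet> y) * inverse (norm y) = 1"
            by (simp add: field_simps)
          then show ?thesis using True by (simp add: mult.commute mult.left_commute)
        next
          case F: False
          then have "y \<bullet> b = 0" using B(3) that step(1) by (auto simp: pairwise_def orthogonal_def)
          then show ?thesis using F by simp
        qed
        then have "(\<Sum>b\<in>B-{0}. (y \<bullet> (b /\<^sub>R norm b)) *\<^sub>R (b /\<^sub>R norm b)) = (\<Sum>b\<in>B-{0}. if b = y then y else 0)"
          by (rule sum.cong[OF refl])
        then show ?thesis using False step(1) B(1) by simp
      qed simp
      then have "c *\<^sub>R (\<Sum>b\<in>B-{0}. (y \<bullet> (b /\<^sub>R norm b)) *\<^sub>R (b /\<^sub>R norm b)) = c *\<^sub>R y" by simp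
      then show ?case using step(2)
        by (simp add: inner_add_left scaleR_add_left sum.distrib scaleR_right.sum algebra_simps)
    qed
    then show ?thesis unfolding N_def by (subst sum.reindex[OF inj]) simp
  qed
  then have "expansion_basis N" using B(1) unfolding expansion_basis_def N_def by auto
  then show ?thesis by blast
qed

lemma frechet_derivative_expand:
  assumes "expansion_basis (B::'a::real_inner set)" "f differentiable (at x)"
  shows "frechet_derivative f (at x) v = (\<Sum>b\<in>B. (v \<bullet> b) *\<^sub>R frechet_derivative f (at x) b)"
proof -
  have l: "linear (frechet_derivative f (at x))"
    using assms(2) by (simp add: linear_frechet_derivative)
  have "frechet_derivative f (at x) (\<Sum>b\<in>B. (v \<bullet> b) *\<^sub>R b) =
      (\<Sum>b\<in>B. (v \<bullet> b) *\<^sub>R frechet_derivative f (at x) b)"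
    by (simp add: linear_sum[OF l] linear_scale[OF l])
  then show ?thesis using assms(1) by (simp add: expansion_basis_def)
qed

text \<open>The chain rule yields the derivative of \<open>f\<close> in the direction
  \<open>Dg(x) v\<close>, which varies with \<open>x\<close>, whereas \<open>Ck_on\<close> controls
  fixed directions only. Expanding this direction in the finite family \<open>B\<close> gives a
  finite sum of products to which the induction hypothesis applies.\<close>

lemma Ck_on_compose:
  fixes g :: "'a::real_normed_vector \<Rightarrow> 'b::real_inner" and f :: "'b \<Rightarrow> 'c::real_normed_vector"
  assumes B: "expansion_basis (B::'b set)" and S: "open S" and T: "open T" and gS: "g ` S \<subseteq> T"
  shows "Ck_on k S g \<Longrightarrow> Ck_on k T f \<Longrightarrow> Ck_on k S (\<lambda>x. f (g x))"
proof (induction k arbitrary: f)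
  case 0
  then show ?case using gS by (auto intro: continuous_on_compose2)
next
  case (Suc k)
  have fd: "(f has_derivative frechet_derivative f (at (g x))) (at (g x))" if "x \<in> S" for x
    using gS that by (intro Ck_on_Suc_has_derivative[OF Suc.prems(2)]) auto
  have gd: "(g has_derivative frechet_derivative g (at x)) (at x)" if "x \<in> S" for x
    by (rule Ck_on_Suc_has_derivative[OF Suc.prems(1) that])
  show ?case
  proof (rule Ck_on_SucI[OF S, where F="\<lambda>x v. \<Sum>b\<in>B. (frechet_derivative g (at x) v \<bullet> b) *\<^sub>R
      frechet_derivative f (at (g x)) b"])
    fix x assume x: "x \<in> S"
    have D: "((\<lambda>x. f (g x)) has_derivative (\<lambda>v. frechet_derivative f (at (g x)) (frechet_derivative g (at x) v))) (at x)"
      by (rule has_derivative_compose[OF gd[OF x] fd[OF x]])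
    have "(\<lambda>v. frechet_derivative f (at (g x)) (frechet_derivative g (at x) v)) =
        (\<lambda>v. \<Sum>b\<in>B. (frechet_derivative g (at x) v \<bullet> b) *\<^sub>R frechet_derivative f (at (g x)) b)"
      by (rule ext) (rule frechet_derivative_expand[OF B differentiableI[OF fd[OF x]]])
    then show "((\<lambda>x. f (g x)) has_derivative (\<lambda>v. \<Sum>b\<in>B. (frechet_derivative g (at x) v \<bullet> b) *\<^sub>R
      frechet_derivative f (at (g x)) b)) (at x)" by (rule has_derivative_eq_rhs[OF D])
  next
    fix v
    have "Ck_on k S (\<lambda>x. frechet_derivative f (at (g x)) b)" for b
      by (rule Suc.IH[where f="\<lambda>y. frechet_derivative f (at y) b"])
        (fact Ck_on_SucD[OF Suc.prems(1)] Ck_on_Suc_frechet_derivative[OF Suc.prems(2)])+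
    moreover have "Ck_on k S (\<lambda>x. frechet_derivative g (at x) v \<bullet> b)" for b
      by (rule Ck_on_linear_compose[OF S bounded_linear_inner_left])
        (rule Ck_on_Suc_frechet_derivative[OF Suc.prems(1)])
    ultimately show "Ck_on k S (\<lambda>x. \<Sum>b\<in>B. (frechet_derivative g (at x) v \<bullet> b) *\<^sub>R frechet_derivative f (at (g x)) b)"
      by (intro Ck_on_sum[OF S] Ck_on_bilinear[OF bounded_bilinear_scaleR S])
  qed
qed

section \<open>Closure properties of infinitely differentiable maps\<close>

lemma smooth_on_const: "open S \<Longrightarrow> smooth_on S (\<lambda>x. c)"
  by (simp add: smooth_on_def Ck_on_const)

lemma smooth_on_linear: "open S \<Longrightarrow> bounded_linear L \<Longrightarrow> smooth_on S L"
  by (simp add: smooth_on_def Ck_on_linear)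

lemma smooth_on_add: "open S \<Longrightarrow> smooth_on S f \<Longrightarrow> smooth_on S g \<Longrightarrow> smooth_on S (\<lambda>x. f x + g x)"
  by (simp add: smooth_on_def Ck_on_add)

lemma smooth_on_mult:
  fixes f g :: "_ \<Rightarrow> real"
  shows "open S \<Longrightarrow> smooth_on S f \<Longrightarrow> smooth_on S g \<Longrightarrow> smooth_on S (\<lambda>x. f x * g x)"
  by (simp add: smooth_on_def Ck_on_bilinear[OF bounded_bilinear_mult])

lemma smooth_on_cmult:
  fixes f :: "_ \<Rightarrow> real"
  shows "open S \<Longrightarrow> smooth_on S f \<Longrightarrow> smooth_on S (\<lambda>x. c * f x)"
  by (intro smooth_on_mult smooth_on_const)

lemma smooth_on_diff:
  fixes f :: "_ \<Rightarrow> real"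
  assumes "open S" "smooth_on S f" "smooth_on S g"
  shows "smooth_on S (\<lambda>x. f x - g x)"
  using smooth_on_add[OF assms(1,2) smooth_on_cmult[OF assms(1,3), of "-1"]] by simp

lemma smooth_on_inner:
  "open S \<Longrightarrow> smooth_on S f \<Longrightarrow> smooth_on S g \<Longrightarrow> smooth_on S (\<lambda>x. f x \<bullet> g x)"
  by (simp add: smooth_on_def Ck_on_bilinear[OF bounded_bilinear_inner])

lemma smooth_on_sum:
  "open S \<Longrightarrow> (\<And>i. i \<in> I \<Longrightarrow> smooth_on S (f i)) \<Longrightarrow> smooth_on S (\<lambda>x. \<Sum>i\<in>I. f i x)"
  by (simp add: smooth_on_def Ck_on_sum)

lemma smooth_on_compose:
  fixes g :: "'a::real_normed_vector \<Rightarrow> 'b::real_inner" and f :: "'b \<Rightarrow> 'c::real_normed_vector"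
  assumes "expansion_basis (B::'b set)" "open S" "open T" "g ` S \<subseteq> T" "smooth_on S g" "smooth_on T f"
  shows "smooth_on S (\<lambda>x. f (g x))"
  using Ck_on_compose[OF assms(1-4)] assms(5,6) unfolding smooth_on_def by blast

section \<open>Bump functions\<close>

text \<open>The family \<open>e\<^sup>-\<^sup>1\<^sup>/\<^sup>t t\<^sup>-\<^sup>n\<close> is closed under differentiation up to linear combinations.\<close>

definition flat_exp :: "nat \<Rightarrow> real \<Rightarrow> real" where
  "flat_exp n t = (if t > 0 then exp (- inverse t) * inverse t ^ n else 0)"

text \<open>From the right, substituting the reciprocal of \<open>t\<close> turns the claim into the
  decay of a power divided by the exponential at infinity; from the left the function is constantly
  0.\<close>

lemma flat_exp_tendsto_0: "(flat_exp n \<longlongrightarrow> 0) (at 0)"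
proof -
  have "((\<lambda>t::real. inverse t ^ n / exp (inverse t)) \<longlongrightarrow> 0) (at_right 0)"
    by (rule filterlim_compose[OF tendsto_power_div_exp_0 filterlim_inverse_at_top_right])
  moreover have "eventually (\<lambda>t::real. inverse t ^ n / exp (inverse t) = flat_exp n t) (at_right 0)"
    unfolding eventually_at_filter by (simp add: flat_exp_def exp_minus divide_inverse mult.commute)
  ultimately have "(flat_exp n \<longlongrightarrow> 0) (at_right 0)"
    by (rule Lim_transform_eventually)
  moreover have "(flat_exp n \<longlongrightarrow> 0) (at_left 0)"
    by (rule Lim_transform_eventually[OF tendsto_const])
      (simp add: eventually_at_filter flat_exp_def)
  ultimately show ?thesis by (simp add: filterlim_at_split)
qed

lemma flat_exp_has_derivative:
  "(flat_exp n has_real_derivative flat_exp (n + 2) t - n * flat_exp (n + 1) t) (at t)"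
proof -
  consider "t > 0" | "t < 0" | "t = 0" by linarith
  then show ?thesis
  proof cases
    case 1
    \<comment> \<open>For \<open>n = 0\<close> the truncated exponent \<open>n - 1\<close> is
      harmless, since the factor \<open>n\<close> vanishes on both sides.\<close>
    have E: "n * inverse t ^ (n - 1) * (inverse t * inverse t) = n * inverse t ^ (n + 1)"
      by (cases n) (auto simp: algebra_simps)
    have "((\<lambda>t. exp (- inverse t) * inverse t ^ n) has_real_derivative
        exp (- inverse t) * inverse t ^ (n + 2) -
        exp (- inverse t) * (n * inverse t ^ (n - 1) * (inverse t * inverse t))) (at t)"
      by (rule derivative_eq_intros refl | use 1 in \<open>simp add: algebra_simps\<close>)+
    then have "((\<lambda>t. exp (- inverse t) * inverse t ^ n) has_real_derivative
        flat_exp (n + 2) t - n * flat_exp (n + 1) t) (at t)"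
      unfolding E using 1 by (simp add: flat_exp_def mult.left_commute)
    then show ?thesis
      by (rule has_field_derivative_transform_within_open[of _ _ _ "{0<..}"])
        (use 1 in \<open>auto simp: flat_exp_def\<close>)
  next
    case 2
    have "((\<lambda>t. 0) has_real_derivative flat_exp (n + 2) t - n * flat_exp (n + 1) t) (at t)"
      using 2 by (simp add: flat_exp_def)
    then show ?thesis
      by (rule has_field_derivative_transform_within_open[of _ _ _ "{..<0}"])
        (use 2 in \<open>auto simp: flat_exp_def\<close>)
  next
    case 3
    \<comment> \<open>The difference quotient at 0 is again a member of the family,
      \<open>flat_exp (Suc n)\<close>, whose limit is already known.\<close>
    have "((\<lambda>h. (flat_exp n (0 + h) - flat_exp n 0) / h) \<longlongrightarrow> 0) (at 0)"
      by (rule Lim_transform_eventually[OF flat_exp_tendsto_0[of "Suc n"]])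
        (simp add: flat_exp_def divide_inverse)
    then show ?thesis using 3 by (simp add: DERIV_def flat_exp_def)
  qed
qed

lemma smooth_on_flat_exp: "smooth_on UNIV (flat_exp n)"
proof -
  have "Ck_on k UNIV (flat_exp n)" for k
  proof (induction k arbitrary: n)
    case 0
    then show ?case
      by (auto intro!: continuous_at_imp_continuous_on DERIV_isCont[OF flat_exp_has_derivative])
  next
    case (Suc k)
    show ?case
    proof (rule Ck_on_SucI[where F="\<lambda>t v. (flat_exp (n + 2) t + (- real n) * flat_exp (n + 1) t) * v"])
      show "(flat_exp n has_derivative (*) (flat_exp (n + 2) x + - real n * flat_exp (n + 1) x)) (at x)" for x
        using flat_exp_has_derivative[of n x] by (simp add: has_field_derivative_def)
      show "Ck_on k UNIV (\<lambda>t. (flat_exp (n + 2) t + - real n * flat_exp (n + 1) t) * v)" for v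
        by (intro Ck_on_bilinear[OF bounded_bilinear_mult] Ck_on_add Ck_on_const Suc.IH) simp_all
    qed simp
  qed
  then show ?thesis by (simp add: smooth_on_def)
qed

lemma smooth_step_exists:
  "\<exists>s::real \<Rightarrow> real. smooth_on UNIV s \<and> (\<forall>t\<ge>1. s t = 1) \<and> (\<forall>t\<le>0. s t = 0)"
proof -
  let ?e = "flat_exp 0"
  \<comment> \<open>The value of the inner function \<open>?e (1 - t)\<close> at
    \<open>t = 0\<close>. With this choice the outer argument \<open>c - ?e (1 - t)\<close> is at
    most 0 exactly for \<open>t \<le> 0\<close>, and it equals \<open>c\<close> for
    \<open>t \<ge> 1\<close>, where the factor \<open>inverse (?e c)\<close> normalises the result
    to 1.\<close>
  define c where "c = ?e 1"
  have c: "c > 0" by (simp add: c_def flat_exp_def)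
  \<comment> \<open>Nesting \<open>e\<^sup>-\<^sup>1\<^sup>/\<^sup>t\<close> avoids the smoothness of quotients.\<close>
  define s where "s = (\<lambda>t. inverse (?e c) * ?e (c - ?e (1 - t)))"
  have "smooth_on UNIV (\<lambda>t::real. 1 - t)"
    by (intro smooth_on_diff smooth_on_const smooth_on_linear) auto
  then have "smooth_on UNIV (\<lambda>t. ?e (1 - t))"
    by (rule smooth_on_compose[OF expansion_basis_real, rotated 3, OF _ smooth_on_flat_exp]) auto
  then have "smooth_on UNIV (\<lambda>t. c - ?e (1 - t))"
    by (intro smooth_on_diff smooth_on_const) auto
  then have "smooth_on UNIV (\<lambda>t. ?e (c - ?e (1 - t)))"
    by (rule smooth_on_compose[OF expansion_basis_real, rotated 3, OF _ smooth_on_flat_exp]) auto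
  then have "smooth_on UNIV s" unfolding s_def by (intro smooth_on_cmult) auto
  moreover have "s t = 1" if "t \<ge> 1" for t
    using that c by (simp add: s_def flat_exp_def)
  moreover have "s t = 0" if "t \<le> 0" for t
  proof -
    have "c \<le> ?e (1 - t)" using that by (simp add: c_def flat_exp_def field_simps)
    then have "?e (c - ?e (1 - t)) = 0" by (simp add: flat_exp_def[of 0 "c - _"])
    then show ?thesis by (simp add: s_def)
  qed
  ultimately show ?thesis by blast
qed

lemma smooth_bump_exists:
  fixes c :: "'a::real_inner"
  assumes "0 < r" "r < R"
  shows "\<exists>h::'a \<Rightarrow> real. smooth_on UNIV h \<and> (\<forall>x\<in>cball c r. h x = 1) \<and> (\<forall>x. x \<notin> ball c R \<longrightarrow> h x = 0)"
proof -
  obtain s :: "real \<Rightarrow> real" where s: "smooth_on UNIV s" "\<And>t. t \<ge> 1 \<Longrightarrow> s t = 1" "\<And>t. t \<le> 0 \<Longrightarrow> s t = 0"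
    using smooth_step_exists by blast
  \<comment> \<open>The squared distance is smooth at the centre too, unlike the distance. It is
    rescaled affinely so that \<open>q\<close> takes the value 1 on the sphere of radius
    \<open>r\<close> and 0 on the sphere of radius \<open>R\<close>.\<close>
  define q where "q = (\<lambda>x. inverse (R\<^sup>2 - r\<^sup>2) * (R\<^sup>2 - (x - c) \<bullet> (x - c)))"
  have pos: "R\<^sup>2 - r\<^sup>2 > 0" using assms by (simp add: power_strict_mono)
  have "smooth_on UNIV (\<lambda>x. x + (- c))"
    by (intro smooth_on_add smooth_on_const smooth_on_linear) auto
  then have "smooth_on UNIV (\<lambda>x. x - c)" by simp
  then have "smooth_on UNIV q" unfolding q_def
    by (intro smooth_on_cmult smooth_on_diff smooth_on_const smooth_on_inner) auto
  then have "smooth_on UNIV (\<lambda>x. s (q x))"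
    by (rule smooth_on_compose[OF expansion_basis_real, rotated 3, OF _ s(1)]) auto
  moreover have "s (q x) = 1" if "x \<in> cball c r" for x
  proof (rule s(2))
    have "(x - c) \<bullet> (x - c) \<le> r\<^sup>2"
      using that by (metis dist_commute dist_norm mem_cball norm_ge_zero power2_norm_eq_inner power_mono)
    then show "1 \<le> q x" using pos by (simp add: q_def field_simps)
  qed
  moreover have "s (q x) = 0" if "x \<notin> ball c R" for x
  proof (rule s(3))
    have "R \<le> norm (x - c)" using that by (simp add: dist_norm norm_minus_commute)
    then have "R\<^sup>2 \<le> (x - c) \<bullet> (x - c)"
      using assms by (metis less_eq_real_def order_less_trans power2_norm_eq_inner power_mono)
    then show "q x \<le> 0" using pos by (simp add: q_def mult_le_0_iff)
  qed
  ultimately show ?thesis by blast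
qed

section \<open>Compactness of closed balls in the model space\<close>

lemma compact_bounded_combinations:
  fixes F :: "'a::real_normed_vector set"
  assumes "finite F"
  shows "\<exists>K. compact K \<and> (\<forall>t. (\<forall>b\<in>F. \<bar>t b\<bar> \<le> R) \<longrightarrow> (\<Sum>b\<in>F. t b *\<^sub>R b) \<in> K)"
  using assms
proof (induction F)
  case empty
  then show ?case by (intro exI[of _ "{0}"]) auto
next
  case (insert a F)
  then obtain K where K: "compact K" "\<And>t. (\<forall>b\<in>F. \<bar>t b\<bar> \<le> R) \<Longrightarrow> (\<Sum>b\<in>F. t b *\<^sub>R b) \<in> K" by blast
  let ?L = "(\<lambda>t. t *\<^sub>R a) ` {-R..R}"
  have "compact ?L"
    by (intro compact_continuous_image continuous_intros) auto
  then have "compact {x + y | x y. x \<in> ?L \<and> y \<in> K}" using K(1) by (rule compact_sums)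
  moreover have "(\<Sum>b\<in>insert a F. t b *\<^sub>R b) \<in> {x + y | x y. x \<in> ?L \<and> y \<in> K}"
    if "\<forall>b\<in>insert a F. \<bar>t b\<bar> \<le> R" for t
  proof -
    have "t a *\<^sub>R a \<in> ?L" using that by (auto simp: abs_le_iff)
    moreover have "(\<Sum>b\<in>F. t b *\<^sub>R b) \<in> K" using K(2) that by auto
    ultimately show ?thesis using insert.hyps by auto
  qed
  ultimately show ?case by blast
qed

text \<open>A real inner product space need not be locally compact, so the finite family
  \<open>B\<close> has to supply this. By Cauchy-Schwarz all coefficients of points of the ball are
  bounded by one \<open>R\<close>, hence the ball is a closed subset of a compact set of bounded
  combinations.\<close>

lemma expansion_basis_compact_cball:
  fixes c :: "'a::real_inner"
  assumes "expansion_basis (B::'a set)"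
  shows "compact (cball c r)"
proof -
  have fin: "finite B" and ex: "\<And>x. (\<Sum>b\<in>B. (x \<bullet> b) *\<^sub>R b) = x"
    using assms by (auto simp: expansion_basis_def)
  define R where "R = (norm c + r) * (\<Sum>b\<in>B. norm b)"
  obtain K where K: "compact K" "\<And>t. (\<forall>b\<in>B. \<bar>t b\<bar> \<le> R) \<Longrightarrow> (\<Sum>b\<in>B. t b *\<^sub>R b) \<in> K"
    using compact_bounded_combinations[OF fin] by blast
  have "cball c r \<subseteq> K"
  proof
    fix x assume "x \<in> cball c r"
    then have x: "norm x \<le> norm c + r"
      by (metis add.commute diff_add_cancel dist_commute dist_norm mem_cball norm_triangle_le add_left_mono)
    have "\<bar>x \<bullet> b\<bar> \<le> R" if "b \<in> B" for b
    proof -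
      have "\<bar>x \<bullet> b\<bar> \<le> norm x * norm b" by (rule Cauchy_Schwarz_ineq2)
      also have "\<dots> \<le> (norm c + r) * (\<Sum>b\<in>B. norm b)"
        using x that fin by (intro mult_mono member_le_sum) (auto intro: order_trans[OF norm_ge_zero])
      finally show ?thesis by (simp add: R_def)
    qed
    then have "(\<Sum>b\<in>B. (x \<bullet> b) *\<^sub>R b) \<in> K" by (intro K(2)) auto
    then show "x \<in> K" by (simp add: ex)
  qed
  then show ?thesis using K(1) by (metis closed_cball compact_Int_closed inf.absorb_iff2)
qed

section \<open>Hadamard's lemma\<close>

text \<open>The weight \<open>t ^ j\<close> makes the family closed under differentiation: moving
  \<open>x\<close> moves the point of the ray at time \<open>t\<close> at speed \<open>t\<close>, so
  each derivative raises \<open>j\<close> by one.\<close>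

definition ray_integral :: "nat \<Rightarrow> 'a::real_normed_vector \<Rightarrow> ('a \<Rightarrow> real) \<Rightarrow> 'a \<Rightarrow> real" where
  "ray_integral j c u x = integral {0..1} (\<lambda>t. t ^ j * u (c + t *\<^sub>R (x - c)))"

lemma convex_ray_in:
  assumes "convex S" "c \<in> S" "x \<in> S" "t \<in> {0..1::real}"
  shows "c + t *\<^sub>R (x - c) \<in> S"
proof -
  have "(1 - t) *\<^sub>R c + t *\<^sub>R x \<in> S" using assms by (intro convexD) auto
  then show ?thesis by (simp add: algebra_simps)
qed

lemma has_real_derivative_along_line:
  fixes f :: "'a::real_normed_vector \<Rightarrow> real"
  assumes "f differentiable (at (a + t *\<^sub>R v))"
  shows "((\<lambda>t. f (a + t *\<^sub>R v)) has_real_derivative frechet_derivative f (at (a + t *\<^sub>R v)) v) (at t)"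
proof -
  let ?D = "frechet_derivative f (at (a + t *\<^sub>R v))"
  have "(f has_derivative ?D) (at (a + t *\<^sub>R v))"
    using assms frechet_derivative_works by blast
  moreover have "((\<lambda>t. a + t *\<^sub>R v) has_derivative (\<lambda>s. s *\<^sub>R v)) (at t)"
    by (auto intro!: derivative_eq_intros)
  ultimately have "((\<lambda>t. f (a + t *\<^sub>R v)) has_derivative (\<lambda>s. ?D (s *\<^sub>R v))) (at t)"
    by (rule has_derivative_compose[rotated])
  moreover have "(\<lambda>s. ?D (s *\<^sub>R v)) = (*) (?D v)"
    using linear_scale[OF linear_frechet_derivative[OF assms]] by (simp add: fun_eq_iff)
  ultimately show ?thesis by (simp add: has_field_derivative_def)
qed

lemma continuous_on_ray:
  fixes u :: "'a::real_normed_vector \<Rightarrow> real"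
  assumes "convex S" "c \<in> S" "x \<in> S" "continuous_on S u"
  shows "continuous_on {0..1} (\<lambda>t. t ^ j * u (c + t *\<^sub>R (x - c)))"
proof -
  have "continuous_on {0..1} (\<lambda>t. c + t *\<^sub>R (x - c))" by (intro continuous_intros)
  then have "continuous_on {0..1} (\<lambda>t. u (c + t *\<^sub>R (x - c)))"
    by (rule continuous_on_compose2[OF assms(4)]) (use convex_ray_in[OF assms(1-3)] in auto)
  then show ?thesis by (intro continuous_intros)
qed

text \<open>Differentiation under the integral sign. The mean value theorem, applied for each
  \<open>t\<close>, rewrites the increment of \<open>u\<close> through its partial derivatives at an
  intermediate point, and continuity of these partials, uniform in \<open>t\<close>, bounds the
  remainder of the integrand by \<open>e * norm (y - x)\<close>.\<close>

lemma ray_integral_has_derivative: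
  fixes u :: "'a::real_inner \<Rightarrow> real"
  assumes B: "expansion_basis (B::'a set)" and S: "open S" "convex S" "c \<in> S"
    and u: "smooth_on S u" and x: "x \<in> S"
  shows "(ray_integral j c u has_derivative
    (\<lambda>v. \<Sum>b\<in>B. (v \<bullet> b) *\<^sub>R ray_integral (Suc j) c (\<lambda>y. frechet_derivative u (at y) b) x)) (at x)"
    (is "(_ has_derivative ?F) _")
proof -
  have fin: "finite B" using B by (simp add: expansion_basis_def)
  let ?g = "\<lambda>t y. c + t *\<^sub>R (y - c)"
  let ?D = "\<lambda>b y. frechet_derivative u (at y) b"
  have cont: "continuous_on S (?D b)" for b
    by (intro smooth_on_continuous_on smooth_on_frechet_derivative u)
  have "\<exists>d>0. \<forall>y. norm (y - x) < d \<longrightarrow>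
      norm (ray_integral j c u y - ray_integral j c u x - ?F (y - x)) \<le> e * norm (y - x)" if "e > 0" for e
  proof -
    \<comment> \<open>The added 1 keeps \<open>M\<close> positive when the model space is
      zero-dimensional and the sum of norms is 0.\<close>
    define M where "M = (\<Sum>b\<in>B. norm b) + 1"
    have M: "M > 0" unfolding M_def by (intro add_nonneg_pos sum_nonneg) auto
    define e' where "e' = e / M"
    have e': "e' > 0" using \<open>e > 0\<close> M by (simp add: e'_def)
    \<comment> \<open>Compactness of the unit interval provides one neighbourhood of
      \<open>x\<close> that serves all \<open>t\<close> at once.\<close>
    have "\<exists>X. x \<in> X \<and> open X \<and> (\<forall>y\<in>X \<inter> S. \<forall>t\<in>{0..1}. dist (?D b (?g t y)) (?D b (?g t x)) \<le> e')" for b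
    proof -
      have "continuous_on (S \<times> {0..1}) (\<lambda>p. ?g (snd p) (fst p))" by (intro continuous_intros)
      then have "continuous_on (S \<times> {0..1}) (\<lambda>p. ?D b (?g (snd p) (fst p)))"
        by (rule continuous_on_compose2[OF cont]) (use convex_ray_in[OF S(2,3)] in auto)
      then obtain X where "x \<in> X" "open X"
        "\<forall>y\<in>X \<inter> S. \<forall>t\<in>{0..1}. dist (?D b (?g (snd (y, t)) (fst (y, t)))) (?D b (?g (snd (x, t)) (fst (x, t)))) \<le> e'"
        by (rule continuous_on_prod_compactE[OF _ compact_Icc x e'])
      then show ?thesis unfolding fst_conv snd_conv by blast
    qed
    then have "\<exists>X. \<forall>b. x \<in> X b \<and> open (X b) \<and>
        (\<forall>y\<in>X b \<inter> S. \<forall>t\<in>{0..1}. dist (?D b (?g t y)) (?D b (?g t x)) \<le> e')"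
      by (intro choice allI)
    then obtain X where X: "\<And>b. x \<in> X b" "\<And>b. open (X b)"
      "\<And>b y t. y \<in> X b \<Longrightarrow> y \<in> S \<Longrightarrow> t \<in> {0..1} \<Longrightarrow> dist (?D b (?g t y)) (?D b (?g t x)) \<le> e'"
      by blast
    have "open (S \<inter> (\<Inter>b\<in>B. X b))" using fin S X by (intro open_Int open_INT) auto
    moreover have "x \<in> S \<inter> (\<Inter>b\<in>B. X b)" using X x by auto
    ultimately obtain d where d: "d > 0" "ball x d \<subseteq> S \<inter> (\<Inter>b\<in>B. X b)"
      by (meson open_contains_ball)
    have "norm (ray_integral j c u y - ray_integral j c u x - ?F (y - x)) \<le> e * norm (y - x)"
      if y: "norm (y - x) < d" for y
    proof -
      have yS: "y \<in> S" using d(2) y by (auto simp: dist_norm norm_minus_commute subset_iff)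
      \<comment> \<open>The remainder of the first-order expansion at the level of integrands; a
        pointwise bound on it is integrated afterwards.\<close>
      let ?h = "\<lambda>t. t ^ j * u (?g t y) - t ^ j * u (?g t x) -
        (\<Sum>b\<in>B. ((y - x) \<bullet> b) * (t ^ Suc j * ?D b (?g t x)))"
      have int: "(\<lambda>t. t ^ i * w (?g t z)) integrable_on {0..1}"
        if "z \<in> S" "continuous_on S w" for i z and w :: "'a \<Rightarrow> real"
        by (intro integrable_continuous_real continuous_on_ray[OF S(2,3) that])
      have cu: "continuous_on S u" using u smooth_on_continuous_on by blast
      have "norm (?h t) \<le> e * norm (y - x)" if t: "t \<in> {0..1}" for t
      proof -
        \<comment> \<open>The segment from \<open>x\<close> to \<open>y\<close>, seen at time
          \<open>t\<close> of the rays, is a segment in the direction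
          \<open>t *\<^sub>R (y - x)\<close>. Linearity in this direction produces the extra factor
          \<open>t\<close> that raises \<open>t ^ j\<close> to \<open>t ^ Suc j\<close>.\<close>
        have line: "?g t x + s *\<^sub>R (t *\<^sub>R (y - x)) = ?g t (x + s *\<^sub>R (y - x))" for s
          by (simp add: algebra_simps)
        have seg: "x + s *\<^sub>R (y - x) \<in> ball x d" if "s \<in> {0..1}" for s
          using that y mult_left_le_one_le[of "norm (y - x)" s] by (simp add: dist_norm)
        then have gS: "?g t (x + s *\<^sub>R (y - x)) \<in> S" if "s \<in> {0..1}" for s
          using that t d(2) by (intro convex_ray_in[OF S(2,3)]) auto
        have diff: "u differentiable (at (?g t x + s *\<^sub>R (t *\<^sub>R (y - x))))" if "s \<in> {0..1}" for s
          unfolding line by (intro smooth_on_differentiable[OF u] gS that)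
        have "\<exists>s. 0 < s \<and> s < 1 \<and>
          u (?g t x + 1 *\<^sub>R (t *\<^sub>R (y - x))) - u (?g t x + 0 *\<^sub>R (t *\<^sub>R (y - x))) =
          (1 - 0) * ?D (t *\<^sub>R (y - x)) (?g t x + s *\<^sub>R (t *\<^sub>R (y - x)))"
          by (rule MVT2, simp, rule has_real_derivative_along_line, rule diff) auto
        then obtain s where s: "0 < s" "s < 1"
          "u (?g t y) - u (?g t x) = ?D (t *\<^sub>R (y - x)) (?g t (x + s *\<^sub>R (y - x)))"
          unfolding line by auto
        let ?z = "x + s *\<^sub>R (y - x)"
        have "?z \<in> ball x d" using s seg by auto
        then have zS: "?z \<in> S" and zX: "?z \<in> X b" if "b \<in> B" for b
          using d(2) that by blast+
        have "u differentiable (at (?g t ?z))"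
          using gS[of s] s u smooth_on_differentiable by auto
        then have "?D (t *\<^sub>R (y - x)) (?g t ?z) = (\<Sum>b\<in>B. ((t *\<^sub>R (y - x)) \<bullet> b) *\<^sub>R ?D b (?g t ?z))"
          by (rule frechet_derivative_expand[OF B])
        then have "u (?g t y) - u (?g t x) = (\<Sum>b\<in>B. ((y - x) \<bullet> b) * (t * ?D b (?g t ?z)))"
          using s(3) by (simp add: mult_ac)
        then have "t ^ j * u (?g t y) - t ^ j * u (?g t x) =
            t ^ j * (\<Sum>b\<in>B. ((y - x) \<bullet> b) * (t * ?D b (?g t ?z)))"
          by (simp add: right_diff_distrib[symmetric])
        then have "?h t = (\<Sum>b\<in>B. ((y - x) \<bullet> b) * (t ^ Suc j * (?D b (?g t ?z) - ?D b (?g t x))))"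
          by (simp add: sum_distrib_left sum_subtractf[symmetric] algebra_simps)
        also have "norm \<dots> \<le> (\<Sum>b\<in>B. (norm (y - x) * norm b) * (1 * e'))"
        proof (rule order_trans[OF norm_sum], rule sum_mono)
          fix b assume b: "b \<in> B"
          have "\<bar>(y - x) \<bullet> b\<bar> \<le> norm (y - x) * norm b" by (rule Cauchy_Schwarz_ineq2)
          moreover have "\<bar>t ^ Suc j\<bar> \<le> 1" using t by (simp add: power_le_one mult_le_one)
          moreover have "\<bar>?D b (?g t ?z) - ?D b (?g t x)\<bar> \<le> e'"
            using X(3)[OF zX[OF b] zS[OF b] t] by (simp add: dist_real_def)
          ultimately show "norm (((y - x) \<bullet> b) * (t ^ Suc j * (?D b (?g t ?z) - ?D b (?g t x))))
              \<le> (norm (y - x) * norm b) * (1 * e')"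
            unfolding real_norm_def abs_mult by (intro mult_mono) auto
        qed
        also have "\<dots> = norm (y - x) * e' * (\<Sum>b\<in>B. norm b)"
          unfolding sum_distrib_left by (intro sum.cong) simp_all
        also have "\<dots> \<le> norm (y - x) * e' * M"
          using e' by (intro mult_left_mono) (auto simp: M_def)
        finally show ?thesis using M by (simp add: e'_def mult.commute)
      qed
      moreover have hint: "(\<lambda>t. \<Sum>b\<in>B. ((y - x) \<bullet> b) * (t ^ Suc j * ?D b (?g t x))) integrable_on {0..1}"
        by (intro integrable_sum fin integrable_on_mult_right int x cont)
      have "integral {0..1} (\<lambda>t. \<Sum>b\<in>B. ((y - x) \<bullet> b) * (t ^ Suc j * ?D b (?g t x))) = ?F (y - x)"
        unfolding ray_integral_def real_scaleR_def
        by (subst integral_sum[OF fin]) (auto intro!: integrable_on_mult_right int x cont simp del: power_Suc)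
      then have "integral {0..1} ?h = ray_integral j c u y - ray_integral j c u x - ?F (y - x)"
        by (subst integral_diff)
          (auto intro!: hint integrable_diff int x yS cu simp: integral_diff int x yS cu ray_integral_def simp del: power_Suc)
      moreover have "norm (integral {0..1} ?h) \<le> integral {0..1} (\<lambda>t::real. e * norm (y - x))"
      proof (rule integral_norm_bound_integral)
        show "?h integrable_on {0..1}" by (intro integrable_diff int x yS cu hint)
      qed (use calculation in auto)
      ultimately show ?thesis by simp
    qed
    then show ?thesis using d(1) by blast
  qed
  moreover have "bounded_linear ?F"
    by (intro bounded_linear_sum bounded_linear_scaleR_const bounded_linear_inner_left)
  ultimately show ?thesis unfolding has_derivative_at_alt by blast
qed

lemma smooth_on_ray_integral:
  fixes u :: "'a::real_inner \<Rightarrow> real"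
  assumes B: "expansion_basis (B::'a set)" and S: "open S" "convex S" "c \<in> S"
    and u: "smooth_on S u"
  shows "smooth_on S (ray_integral j c u)"
proof -
  have "Ck_on k S (ray_integral j c u)" for k
    using u
  proof (induction k arbitrary: j u)
    case 0
    have "continuous (at x) (ray_integral j c u)" if "x \<in> S" for x
      using ray_integral_has_derivative[OF B S 0 that] has_derivative_continuous by blast
    then show ?case by (simp add: continuous_at_imp_continuous_on)
  next
    case (Suc k)
    show ?case
    proof (rule Ck_on_SucI[OF S(1) ray_integral_has_derivative[OF B S Suc.prems]])
      fix v
      show "Ck_on k S (\<lambda>x. \<Sum>b\<in>B. (v \<bullet> b) *\<^sub>R ray_integral (Suc j) c (\<lambda>y. frechet_derivative u (at y) b) x)"
        by (intro Ck_on_sum S Ck_on_bilinear[OF bounded_bilinear_scaleR] Ck_on_const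
            Suc.IH smooth_on_frechet_derivative Suc.prems)
    qed
  qed
  then show ?thesis by (simp add: smooth_on_def)
qed

text \<open>The quotients \<open>h b\<close> are averages of the partial derivatives along the rays from \<open>c\<close>.\<close>

lemma Hadamard:
  fixes f :: "'a::real_inner \<Rightarrow> real"
  assumes B: "expansion_basis (B::'a set)" and S: "open S" "convex S" "c \<in> S"
    and f: "smooth_on S f"
  shows "\<exists>h. \<forall>b. smooth_on S (h b) \<and> h b c = frechet_derivative f (at c) b \<and>
    (\<forall>x\<in>S. f x = f c + (\<Sum>b\<in>B. ((x - c) \<bullet> b) * h b x))"
proof -
  let ?D = "\<lambda>b y. frechet_derivative f (at y) b"
  have fin: "finite B" using B by (simp add: expansion_basis_def)
  have cont: "continuous_on S (?D b)" for b
    by (intro smooth_on_continuous_on smooth_on_frechet_derivative f)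
  have "f x = f c + (\<Sum>b\<in>B. ((x - c) \<bullet> b) * ray_integral 0 c (?D b) x)" if x: "x \<in> S" for x
  proof -
    let ?g = "\<lambda>t. c + t *\<^sub>R (x - c)"
    have diff: "f differentiable (at (?g t))" if "t \<in> {0..1}" for t
      using f smooth_on_differentiable convex_ray_in[OF S(2,3) x that] by blast
    have "((\<lambda>t. ?D (x - c) (?g t)) has_integral f (?g 1) - f (?g 0)) {0..1}"
    proof (rule fundamental_theorem_of_calculus)
      fix t :: real assume "t \<in> {0..1}"
      then show "((\<lambda>t. f (?g t)) has_vector_derivative ?D (x - c) (?g t)) (at t within {0..1})"
        using has_real_derivative_along_line[OF diff]
        by (auto simp: has_real_derivative_iff_has_vector_derivative intro: has_vector_derivative_at_within)
    qed simp
    then have "f x - f c = integral {0..1} (\<lambda>t. ?D (x - c) (?g t))"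
      by (simp add: integral_unique)
    also have "\<dots> = integral {0..1} (\<lambda>t. \<Sum>b\<in>B. ((x - c) \<bullet> b) * (t ^ 0 * ?D b (?g t)))"
      by (rule integral_cong) (simp add: frechet_derivative_expand[OF B diff, of _ "x - c"])
    also have "\<dots> = (\<Sum>b\<in>B. integral {0..1} (\<lambda>t. ((x - c) \<bullet> b) * (t ^ 0 * ?D b (?g t))))"
      by (intro integral_sum fin integrable_on_mult_right integrable_continuous_real
          continuous_on_ray[OF S(2,3) x cont])
    finally show ?thesis by (simp add: ray_integral_def)
  qed
  moreover have "ray_integral 0 c (?D b) c = ?D b c" for b
    by (simp add: ray_integral_def)
  moreover have "smooth_on S (ray_integral 0 c (?D b))" for b
    by (intro smooth_on_ray_integral[OF B S] smooth_on_frechet_derivative f)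
  ultimately show ?thesis by (intro exI[of _ "\<lambda>b. ray_integral 0 c (?D b)"]) blast
qed

section \<open>Smooth functions and derivations on a manifold\<close>

locale atlas_basis =
  fixes A :: "('m::{t2_space, second_countable_topology}, 'e::real_inner) chart set" and B :: "'e set"
  assumes smooth_manifold: "smooth_manifold A" and basis: "expansion_basis B"
begin

lemma finite_basis: "finite B"
  using basis by (simp add: expansion_basis_def)

lemma chart_at: "\<exists>U \<phi>. (U, \<phi>) \<in> A \<and> p \<in> U"
proof -
  have "(\<Union>(U, \<phi>)\<in>A. U) = UNIV"
    using smooth_manifold unfolding smooth_manifold_def by (elim conjE)
  then have "p \<in> (\<Union>(U, \<phi>)\<in>A. U)" by simp
  then show ?thesis by blast
qed

context
  fixes U \<phi> assumes chart: "(U, \<phi>) \<in> A"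
begin

lemma chart_open: "open U" and chart_open_image: "open (\<phi> ` U)"
  and chart_homeomorphism: "homeomorphism U (\<phi> ` U) \<phi> (chart_inv (U, \<phi>))"
proof -
  have "\<forall>(U, \<phi>)\<in>A. open U \<and> open (\<phi> ` U) \<and> homeomorphism U (\<phi> ` U) \<phi> (chart_inv (U, \<phi>))"
    using smooth_manifold unfolding smooth_manifold_def by (elim conjE)
  from bspec[OF this chart] show "open U" "open (\<phi> ` U)" "homeomorphism U (\<phi> ` U) \<phi> (chart_inv (U, \<phi>))"
    by simp_all
qed

lemma chart_inv_chart: "p \<in> U \<Longrightarrow> chart_inv (U, \<phi>) (\<phi> p) = p"
  using chart_homeomorphism by (simp add: homeomorphism_def)

lemma chart_inv_in: "x \<in> \<phi> ` U \<Longrightarrow> chart_inv (U, \<phi>) x \<in> U"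
  using chart_inv_chart by auto

lemma chart_chart_inv: "x \<in> \<phi> ` U \<Longrightarrow> \<phi> (chart_inv (U, \<phi>) x) = x"
  using chart_inv_chart by auto

lemma chart_image_eq: "N \<subseteq> U \<Longrightarrow> \<phi> ` N = \<phi> ` U \<inter> chart_inv (U, \<phi>) -` N"
  by (auto simp: subset_iff chart_inv_chart)

lemma chart_image_open: "open N \<Longrightarrow> N \<subseteq> U \<Longrightarrow> open (\<phi> ` N)"
  by (subst chart_image_eq)
    (auto intro: continuous_open_preimage[OF homeomorphism_cont2[OF chart_homeomorphism] chart_open_image])

lemma chart_preimage_open: "open T \<Longrightarrow> open (U \<inter> \<phi> -` T)"
  using continuous_open_preimage[OF homeomorphism_cont1[OF chart_homeomorphism] chart_open] .

lemma smooth_functions_chart: "f \<in> smooth_functions A \<Longrightarrow> smooth_on (\<phi> ` U) (f \<circ> chart_inv (U, \<phi>))"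
  using chart by (auto simp: smooth_functions_def)

end

text \<open>One chart around each point suffices: near the point, the expression of \<open>f\<close>
  in any other chart is the given one composed with a smooth transition map.\<close>

lemma smooth_functionsI:
  assumes "\<And>p. \<exists>U \<phi> N. (U, \<phi>) \<in> A \<and> open N \<and> p \<in> N \<and> N \<subseteq> U \<and> smooth_on (\<phi> ` N) (f \<circ> chart_inv (U, \<phi>))"
  shows "f \<in> smooth_functions A"
proof -
  have "smooth_on (\<psi> ` V) (f \<circ> chart_inv (V, \<psi>))" if c: "(V, \<psi>) \<in> A" for V \<psi>
  proof (rule smooth_on_local)
    fix x assume x: "x \<in> \<psi> ` V"
    then obtain p where p: "p \<in> V" "x = \<psi> p" by blast
    obtain U \<phi> N where N: "(U, \<phi>) \<in> A" "open N" "p \<in> N" "N \<subseteq> U" "smooth_on (\<phi> ` N) (f \<circ> chart_inv (U, \<phi>))"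
      using assms[of p] by blast
    let ?T = "\<psi> ` (V \<inter> N)"
    have oT: "open ?T" using chart_open[OF c] N(2) by (intro chart_image_open[OF c]) auto
    have "smooth_on (\<psi> ` (V \<inter> U)) (\<phi> \<circ> chart_inv (V, \<psi>))"
    proof -
      have "\<forall>(U, \<phi>)\<in>A. \<forall>(V, \<psi>)\<in>A. smooth_on (\<phi> ` (U \<inter> V)) (\<psi> \<circ> chart_inv (U, \<phi>))"
        using smooth_manifold unfolding smooth_manifold_def by (elim conjE)
      from bspec[OF this c] N(1) show ?thesis by auto
    qed
    then have tr: "smooth_on ?T (\<phi> \<circ> chart_inv (V, \<psi>))"
      by (rule smooth_on_subset) (use N(4) in auto)
    have "smooth_on ?T (\<lambda>y. (f \<circ> chart_inv (U, \<phi>)) ((\<phi> \<circ> chart_inv (V, \<psi>)) y))"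
      by (rule smooth_on_compose[OF basis oT chart_image_open[OF N(1,2,4)] _ tr N(5)])
        (auto simp: chart_inv_chart[OF c])
    then have "smooth_on ?T (f \<circ> chart_inv (V, \<psi>))"
      by (rule smooth_on_cong[OF oT, rotated])
        (use N(4) in \<open>auto simp: chart_inv_chart[OF c] chart_inv_chart[OF N(1)] subset_iff\<close>)
    then show "\<exists>T. open T \<and> x \<in> T \<and> smooth_on T (f \<circ> chart_inv (V, \<psi>))"
      using oT p N(3) by blast
  qed
  then show ?thesis by (auto simp: smooth_functions_def)
qed

lemma smooth_functions_iff:
  "f \<in> smooth_functions A \<longleftrightarrow>
    (\<forall>U \<phi>. (U, \<phi>) \<in> A \<longrightarrow> smooth_on (\<phi> ` U) (\<lambda>x. f (chart_inv (U, \<phi>) x)))"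
  by (auto simp: smooth_functions_def o_def)

lemma smooth_functions_const: "(\<lambda>x. c) \<in> smooth_functions A"
  unfolding smooth_functions_iff by (intro allI impI smooth_on_const chart_open_image)

lemma smooth_functions_add:
  "f \<in> smooth_functions A \<Longrightarrow> h \<in> smooth_functions A \<Longrightarrow> (\<lambda>x. f x + h x) \<in> smooth_functions A"
  unfolding smooth_functions_iff by (intro allI impI, rule smooth_on_add) (auto intro: chart_open_image)

lemma smooth_functions_mult:
  "f \<in> smooth_functions A \<Longrightarrow> h \<in> smooth_functions A \<Longrightarrow> (\<lambda>x. f x * h x) \<in> smooth_functions A"
  unfolding smooth_functions_iff by (intro allI impI, rule smooth_on_mult) (auto intro: chart_open_image)

lemma smooth_functions_diff:
  "f \<in> smooth_functions A \<Longrightarrow> h \<in> smooth_functions A \<Longrightarrow> (\<lambda>x. f x - h x) \<in> smooth_functions A"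
  unfolding smooth_functions_iff by (intro allI impI, rule smooth_on_diff) (auto intro: chart_open_image)

lemma smooth_functions_sum:
  "(\<And>i. i \<in> I \<Longrightarrow> f i \<in> smooth_functions A) \<Longrightarrow> (\<lambda>x. \<Sum>i\<in>I. f i x) \<in> smooth_functions A"
  by (induction I rule: infinite_finite_induct) (auto intro: smooth_functions_const smooth_functions_add)

lemma smooth_functions_prod:
  "(\<And>i. i \<in> I \<Longrightarrow> f i \<in> smooth_functions A) \<Longrightarrow> (\<lambda>x. \<Prod>i\<in>I. f i x) \<in> smooth_functions A"
  by (induction I rule: infinite_finite_induct) (auto intro: smooth_functions_const smooth_functions_mult)

text \<open>The open set \<open>U\<close> and the open complement of \<open>C\<close> cover the
  manifold; on the first set \<open>f\<close> is smooth by assumption, on the second it is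
  0.\<close>

lemma smooth_functions_extend:
  assumes c: "(U, \<phi>) \<in> A" and C: "closed C" "C \<subseteq> U"
    and 0: "\<And>x. x \<notin> C \<Longrightarrow> f x = 0" and f: "smooth_on (\<phi> ` U) (f \<circ> chart_inv (U, \<phi>))"
  shows "f \<in> smooth_functions A"
proof (rule smooth_functionsI)
  fix p
  show "\<exists>U \<phi> N. (U, \<phi>) \<in> A \<and> open N \<and> p \<in> N \<and> N \<subseteq> U \<and> smooth_on (\<phi> ` N) (f \<circ> chart_inv (U, \<phi>))"
  proof (cases "p \<in> U")
    case True
    then show ?thesis using c f chart_open[OF c] by blast
  next
    case False
    obtain V \<psi> where V: "(V, \<psi>) \<in> A" "p \<in> V" using chart_at by blast
    have o: "open (V - C)" using C chart_open[OF V(1)] by auto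
    have "smooth_on (\<psi> ` (V - C)) (f \<circ> chart_inv (V, \<psi>))"
      by (rule smooth_on_cong[OF _ _ smooth_on_const[of _ 0]])
        (use chart_image_open[OF V(1) o] in \<open>auto simp: 0 chart_inv_chart[OF V(1)]\<close>)
    then show ?thesis using V o False C by blast
  qed
qed

lemma smooth_bump_at:
  assumes c: "(U, \<phi>) \<in> A" and p: "p \<in> U" "p \<in> O'" "open O'"
  shows "\<exists>h N C. h \<in> smooth_functions A \<and> open N \<and> p \<in> N \<and> N \<subseteq> C \<and> (\<forall>x\<in>N. h x = 1) \<and>
    closed C \<and> C \<subseteq> U \<inter> O' \<and> (\<forall>x. x \<notin> C \<longrightarrow> h x = 0)"
proof -
  have "open (\<phi> ` (U \<inter> O'))" using chart_open[OF c] p by (intro chart_image_open[OF c]) auto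
  moreover have "\<phi> p \<in> \<phi> ` (U \<inter> O')" using p by auto
  ultimately obtain R where R: "R > 0" "cball (\<phi> p) R \<subseteq> \<phi> ` (U \<inter> O')"
    using open_contains_cball by blast
  obtain \<beta> :: "'e \<Rightarrow> real" where \<beta>: "smooth_on UNIV \<beta>" "\<And>x. x \<in> cball (\<phi> p) (R/2) \<Longrightarrow> \<beta> x = 1"
    "\<And>x. x \<notin> ball (\<phi> p) R \<Longrightarrow> \<beta> x = 0"
    using smooth_bump_exists[of "R/2" R "\<phi> p"] R(1) by auto
  define C where "C = chart_inv (U, \<phi>) ` cball (\<phi> p) R"
  define N where "N = U \<inter> \<phi> -` ball (\<phi> p) (R/2)"
  define h where "h = (\<lambda>x. if x \<in> U then \<beta> (\<phi> x) else 0)"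
  have sub: "C \<subseteq> U \<inter> O'"
    using R(2) by (auto simp: C_def chart_inv_chart[OF c] subset_iff image_iff; metis chart_inv_chart[OF c])
  have "continuous_on (cball (\<phi> p) R) (chart_inv (U, \<phi>))"
    using homeomorphism_cont2[OF chart_homeomorphism[OF c]] by (rule continuous_on_subset) (use R(2) in blast)
  \<comment> \<open>Closedness in the whole manifold, not merely in \<open>U\<close>, is needed to
    extend by zero. It comes from compactness of the ball in coordinates together with the Hausdorff
    property.\<close>
  then have "compact C" unfolding C_def
    by (rule compact_continuous_image) (rule expansion_basis_compact_cball[OF basis])
  then have C: "closed C" by (rule compact_imp_closed)
  have inC: "x \<in> C" if "x \<in> U" "\<phi> x \<in> cball (\<phi> p) R" for x
    using that by (metis C_def chart_inv_chart[OF c] imageI)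
  have h0: "h x = 0" if "x \<notin> C" for x
  proof (cases "x \<in> U")
    case True
    then have "\<phi> x \<notin> cball (\<phi> p) R" using that inC by blast
    then have "\<phi> x \<notin> ball (\<phi> p) R" using ball_subset_cball by blast
    then show ?thesis by (simp add: h_def \<beta>(3))
  qed (simp add: h_def)
  have "smooth_on (\<phi> ` U) (h \<circ> chart_inv (U, \<phi>))"
    by (rule smooth_on_cong[OF chart_open_image[OF c] _ smooth_on_subset[OF \<beta>(1) subset_UNIV]])
      (auto simp: h_def chart_inv_chart[OF c])
  then have "h \<in> smooth_functions A"
    by (rule smooth_functions_extend[OF c C _ h0, rotated 2]) (use sub in auto)
  moreover have "open N" unfolding N_def by (intro chart_preimage_open[OF c]) auto
  moreover have "p \<in> N" using R(1) p by (simp add: N_def)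
  moreover have "N \<subseteq> C" using R(1) by (auto simp: N_def intro!: inC)
  moreover have "\<forall>x\<in>N. h x = 1" using \<beta>(2) by (auto simp: N_def h_def)
  ultimately show ?thesis using C sub h0 by blast
qed

lemma smooth_bump_point:
  assumes "open O'" "p \<in> O'"
  shows "\<exists>h N C. h \<in> smooth_functions A \<and> open N \<and> p \<in> N \<and> N \<subseteq> C \<and> (\<forall>x\<in>N. h x = 1) \<and>
    closed C \<and> C \<subseteq> O' \<and> (\<forall>x. x \<notin> C \<longrightarrow> h x = 0)"
proof -
  obtain U \<phi> where c: "(U, \<phi>) \<in> A" "p \<in> U" using chart_at by blast
  show ?thesis using smooth_bump_at[OF c assms(2,1)] unfolding le_inf_iff by blast
qed

text \<open>Derivations act on globally defined functions only, so a coordinate has to be cut off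
  before a tangent vector can be applied to it. Where \<open>h\<close> is 1 the coordinate itself is
  retained.\<close>

lemma smooth_functions_cutoff_coordinate:
  assumes c: "(U, \<phi>) \<in> A" and h: "h \<in> smooth_functions A" and C: "closed C" "C \<subseteq> U" "\<And>x. x \<notin> C \<Longrightarrow> h x = 0"
  shows "(\<lambda>x. if x \<in> U then h x * (\<phi> x \<bullet> b) else 0) \<in> smooth_functions A"
proof (rule smooth_functions_extend[OF c C(1,2)])
  have o: "open (\<phi> ` U)" by (rule chart_open_image[OF c])
  have "smooth_on (\<phi> ` U) (\<lambda>x. (h \<circ> chart_inv (U, \<phi>)) x * (x \<bullet> b))"
    by (intro smooth_on_mult o smooth_functions_chart[OF c h] smooth_on_linear bounded_linear_inner_left)
  then show "smooth_on (\<phi> ` U) ((\<lambda>x. if x \<in> U then h x * (\<phi> x \<bullet> b) else 0) \<circ> chart_inv (U, \<phi>))"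
    by (rule smooth_on_cong[OF o, rotated]) (auto simp: chart_inv_chart[OF c])
qed (use C in auto)

section \<open>Tangent vectors as derivations and their coordinate expansion\<close>

lemma tangent_linear:
  assumes "v \<in> tangent_space A p" "f \<in> smooth_functions A" "h \<in> smooth_functions A"
  shows "v (\<lambda>x. a * f x + b * h x) = a * v f + b * v h"
  using assms by (simp add: tangent_space_def)

lemma tangent_mult:
  assumes "v \<in> tangent_space A p" "f \<in> smooth_functions A" "h \<in> smooth_functions A"
  shows "v (\<lambda>x. f x * h x) = f p * v h + h p * v f"
  using assms by (simp add: tangent_space_def)

lemma tangent_not_smooth: "v \<in> tangent_space A p \<Longrightarrow> f \<notin> smooth_functions A \<Longrightarrow> v f = 0"
  by (simp add: tangent_space_def)

lemma tangent_const:
  assumes "v \<in> tangent_space A p"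
  shows "v (\<lambda>x. c) = 0"
proof -
  have "v (\<lambda>x. 1 * 1) = 1 * v (\<lambda>x. 1) + 1 * v (\<lambda>x. 1)"
    by (rule tangent_mult[OF assms]) (rule smooth_functions_const)+
  then have "v (\<lambda>x. 1) = 0" by simp
  then show ?thesis
    using tangent_linear[OF assms smooth_functions_const[of 1] smooth_functions_const[of 1], of c 0] by simp
qed

lemma tangent_add:
  assumes "v \<in> tangent_space A p" "f \<in> smooth_functions A" "h \<in> smooth_functions A"
  shows "v (\<lambda>x. f x + h x) = v f + v h"
  using tangent_linear[OF assms, of 1 1] by simp

lemma tangent_diff:
  assumes "v \<in> tangent_space A p" "f \<in> smooth_functions A" "h \<in> smooth_functions A"
  shows "v (\<lambda>x. f x - h x) = v f - v h"
  using tangent_linear[OF assms, of 1 "-1"] by simp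

lemma tangent_sum:
  assumes "v \<in> tangent_space A p" "\<And>i. i \<in> I \<Longrightarrow> f i \<in> smooth_functions A"
  shows "v (\<lambda>x. \<Sum>i\<in>I. f i x) = (\<Sum>i\<in>I. v (f i))"
  using assms(2)
  by (induction I rule: infinite_finite_induct)
    (auto simp: tangent_const[OF assms(1)] tangent_add[OF assms(1)] smooth_functions_sum)

text \<open>If \<open>\<eta>\<close> is 1 near \<open>p\<close> and 0 off \<open>N\<close>, then
  \<open>\<eta> f = \<eta> h\<close> everywhere. In the product rule the terms with
  \<open>v \<eta>\<close> agree because \<open>f p = h p\<close>, and the remaining ones are
  \<open>v f\<close> and \<open>v h\<close>.\<close>

lemma tangent_local:
  assumes v: "v \<in> tangent_space A p" and f: "f \<in> smooth_functions A" "h \<in> smooth_functions A"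
    and N: "open N" "p \<in> N" "\<And>x. x \<in> N \<Longrightarrow> f x = h x"
  shows "v f = v h"
proof -
  obtain \<eta> N' C where \<eta>: "\<eta> \<in> smooth_functions A" "p \<in> N'" "\<forall>x\<in>N'. \<eta> x = 1" "C \<subseteq> N" "\<forall>x. x \<notin> C \<longrightarrow> \<eta> x = 0"
    using smooth_bump_point[OF N(1,2)] by blast
  have "\<eta> x * f x = \<eta> x * h x" for x using \<eta>(4,5) N(3) by (metis mult_zero_left subsetD)
  then have "v (\<lambda>x. \<eta> x * f x) = v (\<lambda>x. \<eta> x * h x)" by (simp only:)
  then show ?thesis using \<eta>(2,3) N(2,3) by (simp add: tangent_mult[OF v \<eta>(1)] f)
qed

lemma tangent_space_zero: "(\<lambda>f. 0) \<in> tangent_space A p"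
  by (simp add: tangent_space_def)

lemma tangent_space_combine:
  assumes "v \<in> tangent_space A p" "w \<in> tangent_space A p"
  shows "(\<lambda>f. a * v f + b * w f) \<in> tangent_space A p"
  using assms by (auto simp: tangent_space_def algebra_simps)

lemma tangent_space_sum:
  assumes "\<And>i. i \<in> I \<Longrightarrow> v i \<in> tangent_space A p"
  shows "(\<lambda>f. \<Sum>i\<in>I. c i * v i f) \<in> tangent_space A p"
  using assms
proof (induction I rule: infinite_finite_induct)
  case (insert i I)
  then show ?case using tangent_space_combine[of "v i" p "\<lambda>f. \<Sum>i\<in>I. c i * v i f" "c i" 1] by simp
qed (auto simp: tangent_space_zero)

context
  fixes U \<phi> assumes chart: "(U, \<phi>) \<in> A"
begin

lemma coord_tangent_in_tangent_space:
  assumes p: "p \<in> U"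
  shows "coord_tangent A (U, \<phi>) p u \<in> tangent_space A p"
proof -
  let ?i = "chart_inv (U, \<phi>)"
  have D: "(f \<circ> ?i has_derivative frechet_derivative (f \<circ> ?i) (at (\<phi> p))) (at (\<phi> p))"
    if "f \<in> smooth_functions A" for f
    using smooth_functions_chart[OF chart that] p by (intro smooth_on_has_derivative) auto
  have i: "?i (\<phi> p) = p" by (rule chart_inv_chart[OF chart p])
  have "coord_tangent A (U, \<phi>) p u (\<lambda>x. a * f x + b * h x) =
      a * coord_tangent A (U, \<phi>) p u f + b * coord_tangent A (U, \<phi>) p u h"
    if f: "f \<in> smooth_functions A" and h: "h \<in> smooth_functions A" for f h a b
  proof -
    have "((\<lambda>x. a * f x + b * h x) \<circ> ?i has_derivative (\<lambda>v. a * frechet_derivative (f \<circ> ?i) (at (\<phi> p)) v +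
        b * frechet_derivative (h \<circ> ?i) (at (\<phi> p)) v)) (at (\<phi> p))"
      using has_derivative_add[OF has_derivative_mult_right[OF D[OF f]] has_derivative_mult_right[OF D[OF h]]]
      by (simp add: o_def)
    moreover have "(\<lambda>x. a * f x + b * h x) \<in> smooth_functions A"
      by (intro smooth_functions_add smooth_functions_mult smooth_functions_const f h)
    ultimately show ?thesis using f h by (simp add: coord_tangent_def frechet_derivative_eqI)
  qed
  moreover have "coord_tangent A (U, \<phi>) p u (\<lambda>x. f x * h x) =
      f p * coord_tangent A (U, \<phi>) p u h + h p * coord_tangent A (U, \<phi>) p u f"
    if f: "f \<in> smooth_functions A" and h: "h \<in> smooth_functions A" for f h
  proof -
    have "((\<lambda>x. f x * h x) \<circ> ?i has_derivative (\<lambda>v. f p * frechet_derivative (h \<circ> ?i) (at (\<phi> p)) v +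
        frechet_derivative (f \<circ> ?i) (at (\<phi> p)) v * h p)) (at (\<phi> p))"
      using has_derivative_mult[OF D[OF f] D[OF h]] by (simp add: o_def i)
    moreover have "(\<lambda>x. f x * h x) \<in> smooth_functions A" by (intro smooth_functions_mult f h)
    ultimately show ?thesis using f h by (simp add: coord_tangent_def frechet_derivative_eqI)
  qed
  ultimately show ?thesis by (simp add: tangent_space_def coord_tangent_def[of _ _ _ _])
qed

text \<open>By Hadamard's lemma, near \<open>p\<close> the function \<open>f\<close> is
  \<open>f p\<close> plus a sum of products \<open>(\<xi> b - \<xi> b p) * q b\<close>. A derivation
  kills the constant, and since the first factor vanishes at \<open>p\<close>, the product rule
  leaves \<open>v (\<xi> b) * q b p\<close>, where \<open>q b p\<close> is the partial derivative of
  \<open>f\<close> in the direction \<open>b\<close>.\<close>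

lemma tangent_eq_coord_sum:
  assumes v: "v \<in> tangent_space A p" and N: "open N" "p \<in> N" "N \<subseteq> U"
    and \<xi>: "\<And>b. b \<in> B \<Longrightarrow> \<xi> b \<in> smooth_functions A" "\<And>b x. b \<in> B \<Longrightarrow> x \<in> N \<Longrightarrow> \<xi> b x = \<phi> x \<bullet> b"
  shows "v = (\<lambda>f. \<Sum>b\<in>B. v (\<xi> b) * coord_tangent A (U, \<phi>) p b f)"
proof
  fix f
  let ?i = "chart_inv (U, \<phi>)"
  show "v f = (\<Sum>b\<in>B. v (\<xi> b) * coord_tangent A (U, \<phi>) p b f)"
  proof (cases "f \<in> smooth_functions A")
    case False
    then show ?thesis using tangent_not_smooth[OF v] by (simp add: coord_tangent_def)
  next
    case f: True
    have p: "p \<in> U" using N by auto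
    have "open (\<phi> ` N)" by (rule chart_image_open[OF chart N(1,3)])
    then obtain r where r: "r > 0" "ball (\<phi> p) r \<subseteq> \<phi> ` N"
      using N(2) open_contains_ball by blast
    have sm: "smooth_on (ball (\<phi> p) r) (f \<circ> ?i)"
      by (rule smooth_on_subset[OF smooth_functions_chart[OF chart f]]) (use r N(3) in blast)
    have pr: "\<phi> p \<in> ball (\<phi> p) r" using r(1) by simp
    obtain k where k: "\<forall>b. smooth_on (ball (\<phi> p) r) (k b) \<and>
        k b (\<phi> p) = frechet_derivative (f \<circ> ?i) (at (\<phi> p)) b \<and>
        (\<forall>x\<in>ball (\<phi> p) r. (f \<circ> ?i) x = (f \<circ> ?i) (\<phi> p) + (\<Sum>b\<in>B. ((x - \<phi> p) \<bullet> b) * k b x))"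
      using Hadamard[OF basis open_ball convex_ball pr sm] by (elim exE)
    have k: "\<And>b. smooth_on (ball (\<phi> p) r) (k b)"
      "\<And>b. k b (\<phi> p) = frechet_derivative (f \<circ> ?i) (at (\<phi> p)) b"
      "\<And>x. x \<in> ball (\<phi> p) r \<Longrightarrow> (f \<circ> ?i) x = (f \<circ> ?i) (\<phi> p) + (\<Sum>b\<in>B. ((x - \<phi> p) \<bullet> b) * k b x)"
      by (rule k[THEN spec, THEN conjunct1], rule k[THEN spec, THEN conjunct2, THEN conjunct1],
          rule k[THEN spec, THEN conjunct2, THEN conjunct2, THEN bspec])
    let ?O = "U \<inter> \<phi> -` ball (\<phi> p) r"
    have O: "open ?O" "p \<in> ?O" using chart_preimage_open[OF chart] r(1) p by auto
    have ON: "?O \<subseteq> N" using r(2) N(3) chart_inv_chart[OF chart] by (auto simp: subset_iff image_iff; metis)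
    obtain \<eta> N' C where \<eta>: "\<eta> \<in> smooth_functions A" "open N'" "p \<in> N'" "N' \<subseteq> C" "\<forall>x\<in>N'. \<eta> x = 1"
      "closed C" "C \<subseteq> ?O" "\<forall>x. x \<notin> C \<longrightarrow> \<eta> x = 0"
      using smooth_bump_point[OF O] by blast
    \<comment> \<open>The Hadamard quotients live on a coordinate ball only; multiplying by
      \<open>\<eta>\<close> makes them global without changing them on \<open>N'\<close>.\<close>
    define q where "q = (\<lambda>b x. if x \<in> ?O then \<eta> x * k b (\<phi> x) else 0)"
    have q: "q b \<in> smooth_functions A" for b
    proof (rule smooth_functionsI)
      fix y
      show "\<exists>U \<phi> N. (U, \<phi>) \<in> A \<and> open N \<and> y \<in> N \<and> N \<subseteq> U \<and> smooth_on (\<phi> ` N) (q b \<circ> chart_inv (U, \<phi>))"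
      proof (cases "y \<in> ?O")
        case True
        have "\<phi> ` ?O \<subseteq> ball (\<phi> p) r" by auto
        moreover have oO: "open (\<phi> ` ?O)" by (rule chart_image_open[OF chart O(1)]) auto
        ultimately have "smooth_on (\<phi> ` ?O) (\<lambda>x. (\<eta> \<circ> ?i) x * k b x)"
          by (intro smooth_on_mult smooth_on_subset[OF k(1)] smooth_on_subset[OF smooth_functions_chart[OF chart \<eta>(1)]]) auto
        then have "smooth_on (\<phi> ` ?O) (q b \<circ> ?i)"
          by (rule smooth_on_cong[OF oO, rotated]) (auto simp: q_def chart_inv_chart[OF chart])
        then show ?thesis using chart O(1) True by blast
      next
        case False
        obtain V \<psi> where V: "(V, \<psi>) \<in> A" "y \<in> V" using chart_at by blast
        have o: "open (V - C)" using \<eta>(6) chart_open[OF V(1)] by auto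
        have "smooth_on (\<psi> ` (V - C)) (q b \<circ> chart_inv (V, \<psi>))"
          by (rule smooth_on_cong[OF _ _ smooth_on_const[of _ 0]])
            (use chart_image_open[OF V(1) o] \<eta>(8) in \<open>auto simp: q_def chart_inv_chart[OF V(1)]\<close>)
        then show ?thesis using V o False \<eta>(7) by blast
      qed
    qed
    have loc: "f x = f p + (\<Sum>b\<in>B. (\<xi> b x - \<xi> b p) * q b x)" if "x \<in> N'" for x
    proof -
      have x: "x \<in> ?O" using that \<eta>(4,7) by auto
      have "(f \<circ> ?i) (\<phi> x) = (f \<circ> ?i) (\<phi> p) + (\<Sum>b\<in>B. ((\<phi> x - \<phi> p) \<bullet> b) * k b (\<phi> x))"
        using x by (intro k(3)) auto
      moreover have "(\<Sum>b\<in>B. ((\<phi> x - \<phi> p) \<bullet> b) * k b (\<phi> x)) = (\<Sum>b\<in>B. (\<xi> b x - \<xi> b p) * q b x)"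
      proof (rule sum.cong[OF refl])
        fix b assume b: "b \<in> B"
        have "\<xi> b x = \<phi> x \<bullet> b" "\<xi> b p = \<phi> p \<bullet> b" using x ON N(2) \<xi>(2)[OF b] by auto
        then show "((\<phi> x - \<phi> p) \<bullet> b) * k b (\<phi> x) = (\<xi> b x - \<xi> b p) * q b x"
          using x \<eta>(5) that by (simp add: q_def inner_diff_left)
      qed
      ultimately show ?thesis using x p by (simp add: chart_inv_chart[OF chart])
    qed
    have sd: "(\<lambda>x. \<xi> b x - \<xi> b p) \<in> smooth_functions A" if "b \<in> B" for b
      by (intro smooth_functions_diff \<xi>(1) that smooth_functions_const)
    have sp: "(\<lambda>x. (\<xi> b x - \<xi> b p) * q b x) \<in> smooth_functions A" if "b \<in> B" for b
      by (intro smooth_functions_mult sd that q)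
    have "v f = v (\<lambda>x. f p + (\<Sum>b\<in>B. (\<xi> b x - \<xi> b p) * q b x))"
      by (rule tangent_local[OF v f _ \<eta>(2,3) loc])
        (auto intro!: smooth_functions_add smooth_functions_sum smooth_functions_const sp)
    also have "\<dots> = v (\<lambda>x. f p) + v (\<lambda>x. \<Sum>b\<in>B. (\<xi> b x - \<xi> b p) * q b x)"
      by (intro tangent_add[OF v] smooth_functions_sum smooth_functions_const sp)
    also have "\<dots> = (\<Sum>b\<in>B. v (\<lambda>x. (\<xi> b x - \<xi> b p) * q b x))"
      by (simp add: tangent_const[OF v] tangent_sum[OF v sp])
    also have "\<dots> = (\<Sum>b\<in>B. v (\<xi> b) * coord_tangent A (U, \<phi>) p b f)"
    proof (rule sum.cong[OF refl])
      fix b assume b: "b \<in> B"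
      have "q b p = frechet_derivative (f \<circ> ?i) (at (\<phi> p)) b"
        using O(2) \<eta>(3,5) k(2) by (simp add: q_def)
      moreover have "v (\<lambda>x. \<xi> b x - \<xi> b p) = v (\<xi> b)"
        by (simp add: tangent_diff[OF v \<xi>(1)[OF b] smooth_functions_const] tangent_const[OF v])
      ultimately show "v (\<lambda>x. (\<xi> b x - \<xi> b p) * q b x) = v (\<xi> b) * coord_tangent A (U, \<phi>) p b f"
        by (simp add: tangent_mult[OF v sd[OF b] q] coord_tangent_def f)
    qed
    finally show ?thesis .
  qed
qed

lemma local_coordinates:
  assumes "p \<in> U"
  shows "\<exists>\<xi> N. open N \<and> p \<in> N \<and> N \<subseteq> U \<and> (\<forall>b. \<xi> b \<in> smooth_functions A) \<and> (\<forall>b. \<forall>x\<in>N. \<xi> b x = \<phi> x \<bullet> b)"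
proof -
  obtain h N C where h: "h \<in> smooth_functions A" "open N" "p \<in> N" "N \<subseteq> C" "\<forall>x\<in>N. h x = 1"
    "closed C" "C \<subseteq> U" "\<forall>x. x \<notin> C \<longrightarrow> h x = 0"
    using smooth_bump_point[OF chart_open[OF chart] assms] by blast
  have "(\<lambda>x. if x \<in> U then h x * (\<phi> x \<bullet> b) else 0) \<in> smooth_functions A" for b
    by (rule smooth_functions_cutoff_coordinate[OF chart h(1,6,7)]) (use h(8) in auto)
  then show ?thesis using h
    by (intro exI[of _ "\<lambda>b x. if x \<in> U then h x * (\<phi> x \<bullet> b) else 0"] exI[of _ N]) auto
qed

end

end

section \<open>Vector fields and the global frame\<close>

lemma bilinear_between_left_combine:
  "bilinear_between V W \<beta> \<Longrightarrow> v \<in> V \<Longrightarrow> v' \<in> V \<Longrightarrow> w \<in> W \<Longrightarrow>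
    \<beta> (\<lambda>f. a * v f + b * v' f) w = a * \<beta> v w + b * \<beta> v' w"
  by (simp add: bilinear_between_def)

lemma bilinear_between_zero_left:
  assumes "bilinear_between V W \<beta>" "v \<in> V" "w \<in> W"
  shows "\<beta> (\<lambda>f. 0) w = 0"
  using bilinear_between_left_combine[OF assms(1,2,2,3), of 0 0] by simp

context atlas_basis
begin

lemma vector_fieldsI:
  assumes "\<And>p. X p \<in> tangent_space A p"
    and "\<And>f. f \<in> smooth_functions A \<Longrightarrow> (\<lambda>p. X p f) \<in> smooth_functions A"
  shows "X \<in> vector_fields A"
  using assms by (simp add: vector_fields_def)

lemma vector_field_tangent: "X \<in> vector_fields A \<Longrightarrow> X p \<in> tangent_space A p"
  by (simp add: vector_fields_def)

lemma vector_field_smooth: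
  "X \<in> vector_fields A \<Longrightarrow> f \<in> smooth_functions A \<Longrightarrow> (\<lambda>p. X p f) \<in> smooth_functions A"
  by (simp add: vector_fields_def)

lemma vector_fields_zero: "(\<lambda>p f. 0) \<in> vector_fields A"
  by (intro vector_fieldsI tangent_space_zero smooth_functions_const)

lemma vector_fields_scale:
  assumes "c \<in> smooth_functions A" "X \<in> vector_fields A"
  shows "vf_scale c X \<in> vector_fields A"
proof (rule vector_fieldsI)
  show "vf_scale c X p \<in> tangent_space A p" for p
    using tangent_space_combine[OF vector_field_tangent[OF assms(2)] tangent_space_zero, where a="c p" and b=0]
    by (simp add: vf_scale_def)
qed (use assms in \<open>simp add: vf_scale_def smooth_functions_mult vector_field_smooth\<close>)

lemma vector_fields_add:
  assumes "X \<in> vector_fields A" "Y \<in> vector_fields A"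
  shows "vf_add X Y \<in> vector_fields A"
proof (rule vector_fieldsI)
  show "vf_add X Y p \<in> tangent_space A p" for p
    using tangent_space_combine[OF assms[THEN vector_field_tangent], where a=1 and b=1] by (simp add: vf_add_def)
qed (use assms in \<open>simp add: vf_add_def smooth_functions_add vector_field_smooth\<close>)

lemma vector_fields_sum:
  assumes "finite I" "\<And>i. i \<in> I \<Longrightarrow> c i \<in> smooth_functions A" "\<And>i. i \<in> I \<Longrightarrow> X i \<in> vector_fields A"
  shows "(\<lambda>p f. \<Sum>i\<in>I. c i p * X i p f) \<in> vector_fields A"
  using assms
proof (induction I)
  case (insert i I)
  then have "vf_add (vf_scale (c i) (X i)) (\<lambda>p f. \<Sum>i\<in>I. c i p * X i p f) \<in> vector_fields A"
    by (intro vector_fields_add vector_fields_scale) auto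
  then show ?case using insert.hyps by (simp add: vf_add_def vf_scale_def)
qed (simp add: vector_fields_zero)

text \<open>The point of this form is that the expansion of \<open>h q * v f\<close> holds at every
  \<open>q\<close> of the manifold. On the set \<open>C\<close> it is the coordinate expansion
  multiplied by \<open>h q\<close>; off \<open>C\<close> both sides vanish, whatever the values of
  the functions \<open>F b\<close> there.\<close>

lemma cutoff_frame_at:
  "\<exists>h F E N. h \<in> smooth_functions A \<and> (\<forall>b. F b \<in> smooth_functions A) \<and> (\<forall>b. E b \<in> vector_fields A) \<and>
    (\<forall>q. \<forall>v\<in>tangent_space A q. \<forall>f. h q * v f = (\<Sum>b\<in>B. v (F b) * E b q f)) \<and>
    open N \<and> p \<in> N \<and> (\<forall>x\<in>N. h x = 1)"
proof -
  obtain U \<phi> where c: "(U, \<phi>) \<in> A" "p \<in> U" using chart_at by blast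
  obtain F O' where F: "open O'" "p \<in> O'" "O' \<subseteq> U" "\<And>b. F b \<in> smooth_functions A"
    "\<And>b x. x \<in> O' \<Longrightarrow> F b x = \<phi> x \<bullet> b"
    using local_coordinates[OF c] by blast
  \<comment> \<open>The cutoffs are nested: \<open>h\<close> is supported inside \<open>O'\<close>,
    where the functions \<open>F b\<close> are still the true coordinates.\<close>
  obtain h N C where h: "h \<in> smooth_functions A" "open N" "p \<in> N" "\<forall>x\<in>N. h x = 1"
    "closed C" "C \<subseteq> O'" "\<And>x. x \<notin> C \<Longrightarrow> h x = 0"
    using smooth_bump_point[OF F(1,2)] by blast
  define E where "E = (\<lambda>b q f. if q \<in> C then h q * coord_tangent A (U, \<phi>) q b f else 0)"
  have "E b \<in> vector_fields A" for b
  proof (rule vector_fieldsI)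
    fix q
    show "E b q \<in> tangent_space A q"
    proof (cases "q \<in> C")
      case True
      then have "q \<in> U" using h(6) F(3) by blast
      then have t: "coord_tangent A (U, \<phi>) q b \<in> tangent_space A q"
        by (rule coord_tangent_in_tangent_space[OF c(1)])
      show ?thesis using tangent_space_combine[OF t t, where a="h q" and b=0] True by (simp add: E_def)
    qed (simp add: E_def tangent_space_zero)
  next
    fix f assume f: "f \<in> smooth_functions A"
    show "(\<lambda>q. E b q f) \<in> smooth_functions A"
    proof (rule smooth_functions_extend[OF c(1) h(5)])
      have o: "open (\<phi> ` U)" by (rule chart_open_image[OF c(1)])
      have "smooth_on (\<phi> ` U) (\<lambda>x. (h \<circ> chart_inv (U, \<phi>)) x *
          frechet_derivative (f \<circ> chart_inv (U, \<phi>)) (at x) b)"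
        by (intro smooth_on_mult o smooth_functions_chart[OF c(1) h(1)]
            smooth_on_frechet_derivative smooth_functions_chart[OF c(1) f])
      then show "smooth_on (\<phi> ` U) ((\<lambda>q. E b q f) \<circ> chart_inv (U, \<phi>))"
        by (rule smooth_on_cong[OF o, rotated])
          (auto simp: E_def coord_tangent_def f chart_inv_chart[OF c(1)] h(7))
    qed (use h(6) F(3) in \<open>auto simp: E_def\<close>)
  qed
  moreover have "h q * v f = (\<Sum>b\<in>B. v (F b) * E b q f)" if v: "v \<in> tangent_space A q" for q v f
  proof (cases "q \<in> C")
    case True
    then have "v = (\<lambda>f. \<Sum>b\<in>B. v (F b) * coord_tangent A (U, \<phi>) q b f)"
      by (intro tangent_eq_coord_sum[OF c(1) v F(1) _ F(3,4,5)]) (use h(6) in auto)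
    then have "v f = (\<Sum>b\<in>B. v (F b) * coord_tangent A (U, \<phi>) q b f)" by (rule fun_cong)
    then have "h q * v f = h q * (\<Sum>b\<in>B. v (F b) * coord_tangent A (U, \<phi>) q b f)" by (rule arg_cong)
    then show ?thesis using True by (simp add: E_def sum_distrib_left mult.left_commute)
  qed (simp add: E_def h(7))
  ultimately show ?thesis using h(1-4) F(4) by blast
qed

text \<open>Second countability enters through the Lindelof theorem, which leaves countably many
  cutoff frames; weighting them with a partition of unity turns the expansions of
  \<open>h\<^sub>n v\<close> into one of \<open>v\<close>. Repetitions in the enumeration of the
  cover do no harm.\<close>

lemma smooth_frame_exists:
  "\<exists>(F :: nat \<times> 'e \<Rightarrow> 'm \<Rightarrow> real) W. (\<forall>k. F k \<in> smooth_functions A) \<and> (\<forall>k. W k \<in> vector_fields A) \<and>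
    (\<forall>p. \<exists>N. open N \<and> p \<in> N \<and> finite {k. \<exists>q\<in>N. W k q \<noteq> (\<lambda>f. 0)}) \<and>
    (\<forall>p. \<forall>v\<in>tangent_space A p. v = (\<lambda>f. \<Sum>k | W k p \<noteq> (\<lambda>f. 0). v (F k) * W k p f))"
proof -
  define P where "P = (\<lambda>p h F E N. h \<in> smooth_functions A \<and> (\<forall>b. F b \<in> smooth_functions A) \<and> (\<forall>b. E b \<in> vector_fields A) \<and>
    (\<forall>q. \<forall>v\<in>tangent_space A q. \<forall>f. h q * v f = (\<Sum>b\<in>B. v (F b) * E b q f)) \<and>
    open N \<and> p \<in> N \<and> (\<forall>x\<in>N. h x = 1))"
  have "\<forall>p. \<exists>h F E N. P p h F E N" using cutoff_frame_at unfolding P_def by blast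
  then obtain h' F' E' N' where P': "\<And>p. P p (h' p) (F' p) (E' p) (N' p)" by metis
  have "open (N' p)" "p \<in> N' p" for p using P'[of p] by (auto simp: P_def)
  then have "\<And>S. S \<in> range N' \<Longrightarrow> open S" "(\<Union>(range N')) = UNIV" by auto
  then obtain \<N> where \<N>: "\<N> \<subseteq> range N'" "countable \<N>" "\<Union>\<N> = UNIV"
    using Lindelof[of "range N'"] by metis
  have "\<N> \<noteq> {}" using \<N>(3) by auto
  then have "\<forall>n. \<exists>p. from_nat_into \<N> n = N' p"
    using from_nat_into[of \<N>] \<N>(1) by blast
  from choice[OF this] obtain c where c: "\<forall>n. from_nat_into \<N> n = N' (c n)" ..
  define h where "h = (\<lambda>n. h' (c n))"
  define N where "N = (\<lambda>n. N' (c n))"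
  have cover: "\<exists>n. p \<in> N n" for p
  proof -
    have "p \<in> \<Union>\<N>" using \<N>(3) by simp
    then obtain S where S: "S \<in> \<N>" "p \<in> S" by (rule UnionE)
    then obtain n where "from_nat_into \<N> n = S" using from_nat_into_surj[OF \<N>(2)] by blast
    then have "p \<in> N n" using S(2) c by (simp add: N_def)
    then show ?thesis by blast
  qed
  have h: "h n \<in> smooth_functions A" "\<And>x. x \<in> N n \<Longrightarrow> h n x = 1" and N: "open (N n)"
    and F': "\<And>b. F' (c n) b \<in> smooth_functions A" and E': "\<And>b. E' (c n) b \<in> vector_fields A"
    and rep: "\<And>q v f. v \<in> tangent_space A q \<Longrightarrow> h n q * v f = (\<Sum>b\<in>B. v (F' (c n) b) * E' (c n) b q f)" for n
    using P'[of "c n"] by (auto simp: P_def h_def N_def)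
  \<comment> \<open>The products \<open>\<sigma>\<^sub>n h\<^sub>n\<close> form a locally finite partition of unity: \<open>\<sigma>\<^sub>n\<close> vanishes on \<open>N\<^sub>m\<close> for
    \<open>m < n\<close>, and the sum telescopes.\<close>
  define \<sigma> where "\<sigma> = (\<lambda>n q. \<Prod>j<n. 1 - h j q)"
  have \<sigma>: "\<sigma> n \<in> smooth_functions A" for n
    unfolding \<sigma>_def by (intro smooth_functions_prod smooth_functions_diff smooth_functions_const h)
  have telescope: "(\<Sum>n<m. \<sigma> n q * h n q) = 1 - (\<Prod>j<m. 1 - h j q)" for m q
    by (induction m) (auto simp: \<sigma>_def algebra_simps)
  define F where "F = (\<lambda>(n, b). F' (c n) b)"
  \<comment> \<open>The weights go to the fields only, so local finiteness is achieved for
    \<open>W\<close>, while the \<open>F\<close> remain the cut-off coordinates. Indices outside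
    \<open>B\<close> receive the zero field, hence each \<open>n\<close> contributes finitely many
    nonzero fields.\<close>
  define W where "W = (\<lambda>(n, b). if b \<in> B then vf_scale (\<sigma> n) (E' (c n) b) else (\<lambda>p f. 0))"
  have "F k \<in> smooth_functions A" for k by (cases k) (simp add: F_def F')
  moreover have "W k \<in> vector_fields A" for k
    by (cases k) (simp add: W_def vector_fields_scale \<sigma> E' vector_fields_zero)
  moreover have W0: "W k q = (\<lambda>f. 0)" if "q \<in> N m" "k \<notin> {..m} \<times> B" for k q m
  proof (cases k)
    case (Pair n b)
    show ?thesis
    proof (cases "b \<in> B")
      case True
      then have "m < n" using that Pair by auto
      then have "\<sigma> n q = 0" using h(2)[OF that(1)] by (auto simp: \<sigma>_def)
      then show ?thesis by (simp add: W_def Pair vf_scale_def)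
    qed (simp add: W_def Pair)
  qed
  moreover have "\<exists>O'. open O' \<and> p \<in> O' \<and> finite {k. \<exists>q\<in>O'. W k q \<noteq> (\<lambda>f. 0)}" for p
  proof -
    obtain m where m: "p \<in> N m" using cover by blast
    have "{k. \<exists>q\<in>N m. W k q \<noteq> (\<lambda>f. 0)} \<subseteq> {..m} \<times> B" using W0[of _ m] by blast
    then have "finite {k. \<exists>q\<in>N m. W k q \<noteq> (\<lambda>f. 0)}"
      by (rule finite_subset) (simp add: finite_basis)
    then show ?thesis using N m by blast
  qed
  moreover have "v = (\<lambda>f. \<Sum>k | W k p \<noteq> (\<lambda>f. 0). v (F k) * W k p f)" if v: "v \<in> tangent_space A p" for v p
  proof
    fix f
    obtain m where m: "p \<in> N m" using cover by blast
    have "(\<Sum>k | W k p \<noteq> (\<lambda>f. 0). v (F k) * W k p f) = (\<Sum>k\<in>{..m} \<times> B. v (F k) * W k p f)"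
    proof (rule sum.mono_neutral_left)
      show "{k. W k p \<noteq> (\<lambda>f. 0)} \<subseteq> {..m} \<times> B" using W0[OF m] by blast
    qed (auto simp: finite_basis)
    also have "\<dots> = (\<Sum>n\<le>m. \<Sum>b\<in>B. v (F (n, b)) * W (n, b) p f)"
      by (simp add: sum.cartesian_product)
    also have "\<dots> = (\<Sum>n\<le>m. \<sigma> n p * (\<Sum>b\<in>B. v (F' (c n) b) * E' (c n) b p f))"
      by (intro sum.cong refl) (simp add: sum_distrib_left F_def W_def vf_scale_def mult.left_commute)
    also have "\<dots> = (\<Sum>n\<le>m. \<sigma> n p * (h n p * v f))" by (simp add: rep[OF v])
    also have "\<dots> = (\<Sum>n<Suc m. \<sigma> n p * h n p) * v f"
      by (simp add: sum_distrib_right lessThan_Suc_atMost mult.assoc)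
    \<comment> \<open>Since \<open>h m p = 1\<close>, the product up to and including
      \<open>j = m\<close> is 0, so the telescoped weight is 1.\<close>
    also have "\<dots> = v f" unfolding telescope using h(2)[OF m] by simp
    finally show "v f = (\<Sum>k | W k p \<noteq> (\<lambda>f. 0). v (F k) * W k p f)" by simp
  qed
  ultimately show ?thesis by (intro exI[of _ F] exI[of _ W]) blast
qed

end

section \<open>Metrics and connections\<close>

locale atlas_metric = atlas_basis A B
  for A :: "('m::{t2_space, second_countable_topology}, 'e::real_inner) chart set" and B +
  fixes g :: "'m \<Rightarrow> 'm tvec \<Rightarrow> 'm tvec \<Rightarrow> real"
  assumes metric: "pseudo_riemannian_metric A g"
begin

lemma metric_bilinear: "bilinear_between (tangent_space A p) (tangent_space A p) (g p)"
  using metric unfolding pseudo_riemannian_metric_def by (elim conjE) (rule spec)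

lemma metric_sym: "v \<in> tangent_space A p \<Longrightarrow> w \<in> tangent_space A p \<Longrightarrow> g p v w = g p w v"
  using metric unfolding pseudo_riemannian_metric_def by (elim conjE) blast

lemma metric_nondegenerate:
  "v \<in> tangent_space A p \<Longrightarrow> (\<And>w. w \<in> tangent_space A p \<Longrightarrow> g p v w = 0) \<Longrightarrow> v = (\<lambda>f. 0)"
  using metric unfolding pseudo_riemannian_metric_def by (elim conjE) blast

lemma metric_smooth_coord:
  assumes "(U, \<phi>) \<in> A"
  shows "smooth_on (\<phi> ` U) (\<lambda>x. g (chart_inv (U, \<phi>) x) (coord_tangent A (U, \<phi>) (chart_inv (U, \<phi>) x) u)
    (coord_tangent A (U, \<phi>) (chart_inv (U, \<phi>) x) u'))"
proof -
  have "\<forall>(U, \<phi>)\<in>A. \<forall>u u'. smooth_on (\<phi> ` U)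
        (\<lambda>x. let p = chart_inv (U, \<phi>) x in
           g p (coord_tangent A (U, \<phi>) p u) (coord_tangent A (U, \<phi>) p u'))"
    using metric unfolding pseudo_riemannian_metric_def by (elim conjE)
  from bspec[OF this assms] show ?thesis by (simp add: Let_def)
qed

lemma metric_zero_left: "w \<in> tangent_space A p \<Longrightarrow> g p (\<lambda>f. 0) w = 0"
  by (rule bilinear_between_zero_left[OF metric_bilinear])

lemma metric_sum_left:
  assumes "w \<in> tangent_space A p" "\<And>i. i \<in> I \<Longrightarrow> v i \<in> tangent_space A p"
  shows "g p (\<lambda>f. \<Sum>i\<in>I. c i * v i f) w = (\<Sum>i\<in>I. c i * g p (v i) w)"
  using assms(2)
proof (induction I rule: infinite_finite_induct)
  case (insert i I)
  have "g p (\<lambda>f. c i * v i f + 1 * (\<Sum>i\<in>I. c i * v i f)) w =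
      c i * g p (v i) w + 1 * g p (\<lambda>f. \<Sum>i\<in>I. c i * v i f) w"
    using insert.prems
    by (intro bilinear_between_left_combine[OF metric_bilinear] tangent_space_sum assms(1)) auto
  then show ?case using insert by simp
qed (auto simp: metric_zero_left[OF assms(1)])

lemma metric_sum_right:
  assumes "w \<in> tangent_space A p" "\<And>i. i \<in> I \<Longrightarrow> v i \<in> tangent_space A p"
  shows "g p w (\<lambda>f. \<Sum>i\<in>I. c i * v i f) = (\<Sum>i\<in>I. c i * g p w (v i))"
proof -
  have "g p w (\<lambda>f. \<Sum>i\<in>I. c i * v i f) = g p (\<lambda>f. \<Sum>i\<in>I. c i * v i f) w"
    by (intro metric_sym assms tangent_space_sum)
  also have "\<dots> = (\<Sum>i\<in>I. c i * g p (v i) w)" by (rule metric_sum_left[OF assms])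
  finally show ?thesis by (simp add: metric_sym[OF assms(1) assms(2)] cong: sum.cong)
qed

text \<open>Smoothness of the metric is given on pairs of coordinate vectors. Here the first slot is
  passed to arbitrary fields by expanding in the coordinate frame near each point;
  \<open>metric_smooth_fields\<close> then treats the second slot in the same way.\<close>

lemma metric_smooth_field_coord:
  assumes c: "(U, \<phi>) \<in> A" and X: "X \<in> vector_fields A"
  shows "smooth_on (\<phi> ` U) (\<lambda>x. g (chart_inv (U, \<phi>) x) (X (chart_inv (U, \<phi>) x))
    (coord_tangent A (U, \<phi>) (chart_inv (U, \<phi>) x) u))" (is "smooth_on _ ?G")
proof (rule smooth_on_local)
  fix x assume x: "x \<in> \<phi> ` U"
  then obtain p where p: "p \<in> U" "x = \<phi> p" by blast
  obtain \<xi> N where N: "open N" "p \<in> N" "N \<subseteq> U" "\<And>b. \<xi> b \<in> smooth_functions A"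
    "\<And>b x. x \<in> N \<Longrightarrow> \<xi> b x = \<phi> x \<bullet> b"
    using local_coordinates[OF c p(1)] by metis
  have o: "open (\<phi> ` N)" by (rule chart_image_open[OF c N(1,3)])
  have sub: "\<phi> ` N \<subseteq> \<phi> ` U" using N(3) by blast
  have "smooth_on (\<phi> ` N) (\<lambda>x. \<Sum>b\<in>B. ((\<lambda>p. X p (\<xi> b)) \<circ> chart_inv (U, \<phi>)) x *
      g (chart_inv (U, \<phi>) x) (coord_tangent A (U, \<phi>) (chart_inv (U, \<phi>) x) b)
        (coord_tangent A (U, \<phi>) (chart_inv (U, \<phi>) x) u))"
    by (intro smooth_on_sum smooth_on_mult o smooth_on_subset[OF _ sub] smooth_functions_chart[OF c]
        vector_field_smooth[OF X] N(4) metric_smooth_coord[OF c])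
  then have "smooth_on (\<phi> ` N) ?G"
  proof (rule smooth_on_cong[OF o, rotated])
    fix y assume "y \<in> \<phi> ` N"
    then obtain q where q: "q \<in> N" "y = \<phi> q" by blast
    then have qU: "q \<in> U" using N(3) by blast
    have "X q = (\<lambda>f. \<Sum>b\<in>B. X q (\<xi> b) * coord_tangent A (U, \<phi>) q b f)"
      by (rule tangent_eq_coord_sum[OF c vector_field_tangent[OF X] N(1) q(1) N(3,4,5)])
    then have "g q (X q) (coord_tangent A (U, \<phi>) q u) =
        g q (\<lambda>f. \<Sum>b\<in>B. X q (\<xi> b) * coord_tangent A (U, \<phi>) q b f) (coord_tangent A (U, \<phi>) q u)"
      by (rule arg_cong)
    also have "\<dots> = (\<Sum>b\<in>B. X q (\<xi> b) * g q (coord_tangent A (U, \<phi>) q b) (coord_tangent A (U, \<phi>) q u))"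
      by (intro metric_sum_left coord_tangent_in_tangent_space[OF c qU])
    finally show "(\<Sum>b\<in>B. ((\<lambda>p. X p (\<xi> b)) \<circ> chart_inv (U, \<phi>)) y *
        g (chart_inv (U, \<phi>) y) (coord_tangent A (U, \<phi>) (chart_inv (U, \<phi>) y) b)
        (coord_tangent A (U, \<phi>) (chart_inv (U, \<phi>) y) u)) = ?G y"
      using q(2) by (simp add: chart_inv_chart[OF c qU])
  qed
  then show "\<exists>T. open T \<and> x \<in> T \<and> smooth_on T ?G" using o p N(2) by blast
qed

lemma metric_smooth_fields:
  assumes X: "X \<in> vector_fields A" and Y: "Y \<in> vector_fields A"
  shows "(\<lambda>p. g p (X p) (Y p)) \<in> smooth_functions A"
proof (rule smooth_functionsI)
  fix p
  obtain U \<phi> where c: "(U, \<phi>) \<in> A" "p \<in> U" using chart_at by blast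
  obtain \<xi> N where N: "open N" "p \<in> N" "N \<subseteq> U" "\<And>b. \<xi> b \<in> smooth_functions A"
    "\<And>b x. x \<in> N \<Longrightarrow> \<xi> b x = \<phi> x \<bullet> b"
    using local_coordinates[OF c] by metis
  have o: "open (\<phi> ` N)" by (rule chart_image_open[OF c(1) N(1,3)])
  have sub: "\<phi> ` N \<subseteq> \<phi> ` U" using N(3) by blast
  have "smooth_on (\<phi> ` N) (\<lambda>x. \<Sum>b\<in>B. ((\<lambda>p. Y p (\<xi> b)) \<circ> chart_inv (U, \<phi>)) x *
      g (chart_inv (U, \<phi>) x) (X (chart_inv (U, \<phi>) x)) (coord_tangent A (U, \<phi>) (chart_inv (U, \<phi>) x) b))"
    by (intro smooth_on_sum smooth_on_mult o smooth_on_subset[OF _ sub] smooth_functions_chart[OF c(1)]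
        vector_field_smooth[OF Y] N(4) metric_smooth_field_coord[OF c(1) X])
  then have "smooth_on (\<phi> ` N) ((\<lambda>p. g p (X p) (Y p)) \<circ> chart_inv (U, \<phi>))"
  proof (rule smooth_on_cong[OF o, rotated])
    fix y assume "y \<in> \<phi> ` N"
    then obtain q where q: "q \<in> N" "y = \<phi> q" by blast
    then have qU: "q \<in> U" using N(3) by blast
    have "Y q = (\<lambda>f. \<Sum>b\<in>B. Y q (\<xi> b) * coord_tangent A (U, \<phi>) q b f)"
      by (rule tangent_eq_coord_sum[OF c(1) vector_field_tangent[OF Y] N(1) q(1) N(3,4,5)])
    then have "g q (X q) (Y q) = g q (X q) (\<lambda>f. \<Sum>b\<in>B. Y q (\<xi> b) * coord_tangent A (U, \<phi>) q b f)"
      by (rule arg_cong)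
    also have "\<dots> = (\<Sum>b\<in>B. Y q (\<xi> b) * g q (X q) (coord_tangent A (U, \<phi>) q b))"
      by (intro metric_sum_right vector_field_tangent[OF X] coord_tangent_in_tangent_space[OF c(1) qU])
    finally show "(\<Sum>b\<in>B. ((\<lambda>p. Y p (\<xi> b)) \<circ> chart_inv (U, \<phi>)) y *
      g (chart_inv (U, \<phi>) y) (X (chart_inv (U, \<phi>) y)) (coord_tangent A (U, \<phi>) (chart_inv (U, \<phi>) y) b)) =
      ((\<lambda>p. g p (X p) (Y p)) \<circ> chart_inv (U, \<phi>)) y"
      using q(2) by (simp add: chart_inv_chart[OF c(1) qU])
  qed
  then show "\<exists>U \<phi> N. (U, \<phi>) \<in> A \<and> open N \<and> p \<in> N \<and> N \<subseteq> U \<and>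
      smooth_on (\<phi> ` N) ((\<lambda>p. g p (X p) (Y p)) \<circ> chart_inv (U, \<phi>))"
    using c N(1-3) by blast
qed

end

section \<open>Smooth functions on products of charts\<close>

lemma smooth_on_fst:
  assumes B: "expansion_basis (B::'a::real_inner set)" and "open (S::'a set)" "open T" "smooth_on S f"
  shows "smooth_on (S \<times> (T::'b::real_inner set)) (\<lambda>z. f (fst z))"
  by (rule smooth_on_compose[OF B _ \<open>open S\<close> _ _ \<open>smooth_on S f\<close>])
    (use assms in \<open>auto intro: open_Times smooth_on_linear bounded_linear_fst\<close>)

lemma smooth_on_snd:
  assumes B: "expansion_basis (B::'b::real_inner set)" and "open S" "open (T::'b set)" "smooth_on T f"
  shows "smooth_on ((S::'a::real_inner set) \<times> T) (\<lambda>z. f (snd z))"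
  by (rule smooth_on_compose[OF B _ \<open>open T\<close> _ _ \<open>smooth_on T f\<close>])
    (use assms in \<open>auto intro: open_Times smooth_on_linear bounded_linear_snd\<close>)

lemma chart_inv_prod:
  assumes "inj_on \<phi> U" "inj_on \<psi> V" "m \<in> U" "n \<in> V"
  shows "chart_inv (U \<times> V, map_prod \<phi> \<psi>) (\<phi> m, \<psi> n) = (m, n)"
proof -
  have "inj_on (map_prod \<phi> \<psi>) (U \<times> V)" using assms(1,2) by (rule map_prod_inj_on)
  from inv_into_f_f[OF this, of "(m, n)"] show ?thesis using assms by (simp add: chart_inv_def)
qed

section \<open>Affine connections: finite sums and locality\<close>

locale atlas_connection = atlas_metric A B g
  for A :: "('m::{t2_space, second_countable_topology}, 'e::real_inner) chart set" and B g +
  fixes D :: "'m vfield \<Rightarrow> 'm vfield \<Rightarrow> 'm vfield"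
  assumes connection: "affine_connection A D"
begin

lemma connection_field: "X \<in> vector_fields A \<Longrightarrow> Y \<in> vector_fields A \<Longrightarrow> D X Y \<in> vector_fields A"
  using connection unfolding affine_connection_def by (elim conjE) blast

lemma connection_add_left:
  assumes "X \<in> vector_fields A" "X' \<in> vector_fields A" "Y \<in> vector_fields A"
  shows "D (vf_add X X') Y p f = D X Y p f + D X' Y p f"
proof -
  have "D (vf_add X X') Y = vf_add (D X Y) (D X' Y)"
    using connection assms unfolding affine_connection_def by (elim conjE) blast
  then show ?thesis by (simp add: vf_add_def)
qed

lemma connection_scale_left:
  assumes "c \<in> smooth_functions A" "X \<in> vector_fields A" "Y \<in> vector_fields A"
  shows "D (vf_scale c X) Y p f = c p * D X Y p f"
proof -
  have "D (vf_scale c X) Y = vf_scale c (D X Y)"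
    using connection assms unfolding affine_connection_def by (elim conjE) blast
  then show ?thesis by (simp add: vf_scale_def)
qed

lemma connection_add_right:
  assumes "X \<in> vector_fields A" "Y \<in> vector_fields A" "Y' \<in> vector_fields A"
  shows "D X (vf_add Y Y') p f = D X Y p f + D X Y' p f"
proof -
  have "D X (vf_add Y Y') = vf_add (D X Y) (D X Y')"
    using connection assms unfolding affine_connection_def by (elim conjE) blast
  then show ?thesis by (simp add: vf_add_def)
qed

lemma connection_scale_right:
  assumes "c \<in> smooth_functions A" "X \<in> vector_fields A" "Y \<in> vector_fields A"
  shows "D X (vf_scale c Y) p f = X p c * Y p f + c p * D X Y p f"
proof -
  have "D X (vf_scale c Y) = vf_add (vf_scale (lie_derivative X c) Y) (vf_scale c (D X Y))"
    using connection assms unfolding affine_connection_def by (elim conjE) blast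
  then show ?thesis by (simp add: vf_add_def vf_scale_def lie_derivative_def)
qed

lemma connection_sum_left:
  assumes "finite I" "\<And>i. i \<in> I \<Longrightarrow> c i \<in> smooth_functions A" "\<And>i. i \<in> I \<Longrightarrow> X i \<in> vector_fields A"
    and Y: "Y \<in> vector_fields A"
  shows "D (\<lambda>p f. \<Sum>i\<in>I. c i p * X i p f) Y p f = (\<Sum>i\<in>I. c i p * D (X i) Y p f)"
  using assms(1-3)
proof (induction I)
  case empty
  show ?case
    using connection_scale_left[OF smooth_functions_const[of 0] vector_fields_zero Y, of p f] by (simp add: vf_scale_def)
next
  case (insert i I)
  let ?S = "\<lambda>p f. \<Sum>i\<in>I. c i p * X i p f"
  have "D (vf_add (vf_scale (c i) (X i)) ?S) Y p f = D (vf_scale (c i) (X i)) Y p f + D ?S Y p f"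
    using insert by (intro connection_add_left vector_fields_scale vector_fields_sum Y) auto
  moreover have "vf_add (vf_scale (c i) (X i)) ?S = (\<lambda>p f. \<Sum>i\<in>insert i I. c i p * X i p f)"
    using insert.hyps by (simp add: vf_add_def vf_scale_def)
  ultimately show ?case using insert by (simp add: connection_scale_left[OF _ _ Y])
qed

lemma connection_sum_right:
  assumes "finite I" "\<And>i. i \<in> I \<Longrightarrow> c i \<in> smooth_functions A" "\<And>i. i \<in> I \<Longrightarrow> Y i \<in> vector_fields A"
    and X: "X \<in> vector_fields A"
  shows "D X (\<lambda>p f. \<Sum>i\<in>I. c i p * Y i p f) p f = (\<Sum>i\<in>I. X p (c i) * Y i p f + c i p * D X (Y i) p f)"
  using assms(1-3)
proof (induction I)
  case empty
  show ?case
    using connection_scale_right[OF smooth_functions_const[of 0] X vector_fields_zero, of p f] by (simp add: vf_scale_def)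
next
  case (insert i I)
  let ?S = "\<lambda>p f. \<Sum>i\<in>I. c i p * Y i p f"
  have "D X (vf_add (vf_scale (c i) (Y i)) ?S) p f = D X (vf_scale (c i) (Y i)) p f + D X ?S p f"
    using insert by (intro connection_add_right vector_fields_scale vector_fields_sum X) auto
  moreover have "vf_add (vf_scale (c i) (Y i)) ?S = (\<lambda>p f. \<Sum>i\<in>insert i I. c i p * Y i p f)"
    using insert.hyps by (simp add: vf_add_def vf_scale_def)
  ultimately show ?case using insert by (simp add: connection_scale_right[OF _ X])
qed

text \<open>For a bump \<open>h\<close> supported in \<open>N\<close>, the fields \<open>h X\<close>
  and \<open>h X'\<close> are equal globally; linearity over the smooth functions extracts
  \<open>h\<close>, which is 1 at \<open>p\<close>.\<close>

lemma connection_local_left: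
  assumes X: "X \<in> vector_fields A" "X' \<in> vector_fields A" and Y: "Y \<in> vector_fields A"
    and N: "open N" "p \<in> N" "\<And>q. q \<in> N \<Longrightarrow> X q = X' q"
  shows "D X Y p = D X' Y p"
proof
  fix f
  obtain h N' C where h: "h \<in> smooth_functions A" "p \<in> N'" "\<forall>x\<in>N'. h x = 1" "C \<subseteq> N" "\<forall>x. x \<notin> C \<longrightarrow> h x = 0"
    using smooth_bump_point[OF N(1,2)] by blast
  have "vf_scale h X = vf_scale h X'"
    unfolding vf_scale_def fun_eq_iff using h(4,5) N(3) by (metis mult_zero_left subsetD)
  then have "D (vf_scale h X) Y p f = D (vf_scale h X') Y p f" by simp
  then show "D X Y p f = D X' Y p f"
    using h(2,3) by (simp add: connection_scale_left[OF h(1) _ Y] X)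
qed

text \<open>As for the left slot, except that the Leibniz rule adds the derivative of
  \<open>h\<close> times the field at \<open>p\<close>; this term is the same on both sides because
  \<open>Y p = Y' p\<close>.\<close>

lemma connection_local_right:
  assumes Y: "Y \<in> vector_fields A" "Y' \<in> vector_fields A" and X: "X \<in> vector_fields A"
    and N: "open N" "p \<in> N" "\<And>q. q \<in> N \<Longrightarrow> Y q = Y' q"
  shows "D X Y p = D X Y' p"
proof
  fix f
  obtain h N' C where h: "h \<in> smooth_functions A" "p \<in> N'" "\<forall>x\<in>N'. h x = 1" "C \<subseteq> N" "\<forall>x. x \<notin> C \<longrightarrow> h x = 0"
    using smooth_bump_point[OF N(1,2)] by blast
  have "vf_scale h Y = vf_scale h Y'"
    unfolding vf_scale_def fun_eq_iff using h(4,5) N(3) by (metis mult_zero_left subsetD)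
  then have "D X (vf_scale h Y) p f = D X (vf_scale h Y') p f" by simp
  then show "D X Y p f = D X Y' p f"
    using h(2,3) N(2,3) by (simp add: connection_scale_right[OF h(1) X] Y)
qed

end

section \<open>The bi-form of a frame\<close>

locale atlas_frame = atlas_connection A B g D
  for A :: "('m::{t2_space, second_countable_topology}, 'e::real_inner) chart set" and B g D +
  fixes F :: "'k \<Rightarrow> 'm \<Rightarrow> real" and W :: "'k \<Rightarrow> 'm vfield"
  assumes F: "F k \<in> smooth_functions A" and W: "W k \<in> vector_fields A"
    and locally_finite: "\<exists>N. open N \<and> p \<in> N \<and> finite {k. \<exists>q\<in>N. W k q \<noteq> (\<lambda>f. 0)}"
    and frame: "v \<in> tangent_space A p \<Longrightarrow> v = (\<lambda>f. \<Sum>k | W k p \<noteq> (\<lambda>f. 0). v (F k) * W k p f)"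
begin

lemma frame_expand:
  assumes "v \<in> tangent_space A p" "finite K" "\<And>k. W k p \<noteq> (\<lambda>f. 0) \<Longrightarrow> k \<in> K"
  shows "v = (\<lambda>f. \<Sum>k\<in>K. v (F k) * W k p f)"
proof
  fix f
  have "v f = (\<Sum>k | W k p \<noteq> (\<lambda>f. 0). v (F k) * W k p f)"
    using frame[OF assms(1)] by (rule fun_cong)
  also have "\<dots> = (\<Sum>k\<in>K. v (F k) * W k p f)"
    by (rule sum.mono_neutral_left[OF assms(2)]) (use assms(3) in auto)
  finally show "v f = (\<Sum>k\<in>K. v (F k) * W k p f)" .
qed

text \<open>The index \<open>k\<close> is included as soon as \<open>p\<close> lies in the closed support of \<open>W\<^sub>k\<close>, because
  \<open>D\<^sub>Z W\<^sub>k\<close> need not vanish at a mere zero of \<open>W\<^sub>k\<close>.\<close>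

definition near_support :: "'m \<Rightarrow> 'k set" where
  "near_support p = {k. \<forall>N. open N \<longrightarrow> p \<in> N \<longrightarrow> (\<exists>q\<in>N. W k q \<noteq> (\<lambda>f. 0))}"

lemma near_support_subset: "open N \<Longrightarrow> p \<in> N \<Longrightarrow> near_support p \<subseteq> {k. \<exists>q\<in>N. W k q \<noteq> (\<lambda>f. 0)}"
  by (auto simp: near_support_def)

lemma finite_near_support: "finite (near_support p)"
proof -
  obtain N where "open N" "p \<in> N" "finite {k. \<exists>q\<in>N. W k q \<noteq> (\<lambda>f. 0)}"
    using locally_finite by blast
  then show ?thesis using near_support_subset finite_subset by blast
qed

lemma not_near_supportE:
  assumes "k \<notin> near_support p"
  obtains N where "open N" "p \<in> N" "\<And>q. q \<in> N \<Longrightarrow> W k q = (\<lambda>f. 0)"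
  using assms unfolding near_support_def by blast

lemma frame_zero: "k \<notin> near_support p \<Longrightarrow> W k p = (\<lambda>f. 0)"
  by (erule not_near_supportE)

lemma connection_frame_zero_right:
  assumes "k \<notin> near_support p" "X \<in> vector_fields A"
  shows "D X (W k) p = (\<lambda>f. 0)"
proof -
  obtain N where N: "open N" "p \<in> N" "\<And>q. q \<in> N \<Longrightarrow> W k q = (\<lambda>f. 0)"
    using not_near_supportE[OF assms(1)] by blast
  have "D X (W k) p = D X (\<lambda>p f. 0) p"
    by (rule connection_local_right[OF W vector_fields_zero assms(2) N])
  also have "\<dots> = (\<lambda>f. 0)"
    \<comment> \<open>The zero field is treated as an empty combination, for which the coefficient
      and field families are immaterial.\<close>
    using connection_sum_right[of "{}" undefined undefined X p] assms(2) by (simp add: fun_eq_iff)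
  finally show ?thesis .
qed

lemma connection_frame_zero_left:
  assumes "k \<notin> near_support p" "Y \<in> vector_fields A"
  shows "D (W k) Y p = (\<lambda>f. 0)"
proof -
  obtain N where N: "open N" "p \<in> N" "\<And>q. q \<in> N \<Longrightarrow> W k q = (\<lambda>f. 0)"
    using not_near_supportE[OF assms(1)] by blast
  have "D (W k) Y p = D (\<lambda>p f. 0) Y p"
    by (rule connection_local_left[OF W vector_fields_zero assms(2) N])
  also have "\<dots> = (\<lambda>f. 0)"
    using connection_sum_left[of "{}" undefined undefined Y p] assms(2) by (simp add: fun_eq_iff)
  finally show ?thesis .
qed

text \<open>The first summand alone restricts to \<open>g\<close> on the diagonal. The second one vanishes there, and its
  left derivative supplies the terms \<open>X(F\<^sub>k) D\<^sub>Z W\<^sub>k\<close> of the Leibniz rule.\<close>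

definition frame_biform :: "'m biform" where
  "frame_biform = (\<lambda>(m, n) v w. \<Sum>k\<in>near_support n. v (F k) *
    (g n (W k n) w + (\<Sum>l\<in>near_support n. (F l m - F l n) * g n (D (W l) (W k) n) w)))"

text \<open>The index set \<open>near_support n\<close> jumps with \<open>n\<close>, which obstructs
  any smoothness argument. A finite \<open>K\<close> that contains \<open>near_support\<close>
  throughout a neighbourhood can replace it, as all extra terms vanish.\<close>

lemma frame_biform_eq:
  assumes K: "finite K" "near_support n \<subseteq> K" and w: "w \<in> tangent_space A n"
  shows "frame_biform (m, n) v w = (\<Sum>k\<in>K. v (F k) *
    (g n (W k n) w + (\<Sum>l\<in>K. (F l m - F l n) * g n (D (W l) (W k) n) w)))"
proof -
  have "(\<Sum>l\<in>near_support n. (F l m - F l n) * g n (D (W l) (W k) n) w) =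
      (\<Sum>l\<in>K. (F l m - F l n) * g n (D (W l) (W k) n) w)" for k
    by (rule sum.mono_neutral_left[OF K])
      (auto simp: connection_frame_zero_left[OF _ W] metric_zero_left[OF w])
  moreover have "(\<Sum>k\<in>near_support n. v (F k) *
      (g n (W k n) w + (\<Sum>l\<in>K. (F l m - F l n) * g n (D (W l) (W k) n) w))) =
    (\<Sum>k\<in>K. v (F k) * (g n (W k n) w + (\<Sum>l\<in>K. (F l m - F l n) * g n (D (W l) (W k) n) w)))"
    by (rule sum.mono_neutral_left[OF K])
      (auto simp: connection_frame_zero_right[OF _ W] frame_zero metric_zero_left[OF w])
  ultimately show ?thesis by (simp add: frame_biform_def)
qed

lemma connection_tangent: "X \<in> vector_fields A \<Longrightarrow> Y \<in> vector_fields A \<Longrightarrow> D X Y p \<in> tangent_space A p"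
  by (intro vector_field_tangent connection_field)

lemma frame_biform_bilinear: "bilinear_between (tangent_space A m) (tangent_space A n) (frame_biform (m, n))"
  unfolding bilinear_between_def
proof (intro conjI ballI allI)
  fix v v' w a b
  assume w: "w \<in> tangent_space A n"
  show "frame_biform (m, n) (\<lambda>f. a * v f + b * v' f) w =
      a * frame_biform (m, n) v w + b * frame_biform (m, n) v' w"
    by (simp add: frame_biform_def sum_distrib_left sum.distrib[symmetric] algebra_simps)
next
  fix v w w' and a b :: real
  assume w: "w \<in> tangent_space A n" "w' \<in> tangent_space A n"
  have lin: "g n u (\<lambda>f. a * w f + b * w' f) = a * g n u w + b * g n u w'" if "u \<in> tangent_space A n" for u
    using metric_bilinear[of n] w that by (simp add: bilinear_between_def)
  show "frame_biform (m, n) v (\<lambda>f. a * w f + b * w' f) =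
      a * frame_biform (m, n) v w + b * frame_biform (m, n) v w'"
    by (simp add: frame_biform_def lin vector_field_tangent[OF W] connection_tangent[OF W W]
        sum_distrib_left sum.distrib[symmetric] algebra_simps)
qed

lemma induced_metric_frame_biform:
  assumes v: "v \<in> tangent_space A m" and w: "w \<in> tangent_space A m"
  shows "induced_metric frame_biform m v w = g m v w"
proof -
  have "g m v w = g m (\<lambda>f. \<Sum>k\<in>near_support m. v (F k) * W k m f) w"
    using frame_expand[OF v finite_near_support, of m] frame_zero by metis
  also have "\<dots> = (\<Sum>k\<in>near_support m. v (F k) * g m (W k m) w)"
    by (intro metric_sum_left w vector_field_tangent W)
  finally show ?thesis by (simp add: induced_metric_def frame_biform_def)
qed

text \<open>Product rule for \<open>X = \<Sum>\<^sub>k X(F\<^sub>k) W\<^sub>k\<close>, followed by \<open>Z = \<Sum>\<^sub>l Z(F\<^sub>l) W\<^sub>l\<close>.\<close>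

lemma connection_in_frame:
  assumes X: "X \<in> vector_fields A" and Z: "Z \<in> vector_fields A"
  shows "D Z X p f = (\<Sum>k\<in>near_support p. Z p (\<lambda>q. X q (F k)) * W k p f +
    X p (F k) * (\<Sum>l\<in>near_support p. Z p (F l) * D (W l) (W k) p f))"
proof -
  obtain N where N: "open N" "p \<in> N" "finite {k. \<exists>q\<in>N. W k q \<noteq> (\<lambda>f. 0)}"
    using locally_finite by blast
  \<comment> \<open>The rules for \<open>D\<close> apply to combinations of fields with one fixed
    index set, and the expansions of \<open>X\<close> and \<open>Z\<close> must hold on a whole
    neighbourhood of \<open>p\<close>. The larger set \<open>?K\<close> allows this; once everything
    is evaluated at \<open>p\<close>, the sums shrink back to \<open>near_support p\<close>.\<close>
  let ?K = "{k. \<exists>q\<in>N. W k q \<noteq> (\<lambda>f. 0)}"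
  have sub: "near_support p \<subseteq> ?K" by (rule near_support_subset[OF N(1,2)])
  have expand: "Y q = (\<lambda>f. \<Sum>k\<in>?K. Y q (F k) * W k q f)" if "Y \<in> vector_fields A" "q \<in> N" for Y q
    by (rule frame_expand[OF vector_field_tangent[OF that(1)] N(3)]) (use that(2) in auto)
  have smooth: "(\<lambda>q. Y q (F k)) \<in> smooth_functions A" if "Y \<in> vector_fields A" for Y k
    by (rule vector_field_smooth[OF that F])
  have combination: "(\<lambda>q f. \<Sum>k\<in>?K. Y q (F k) * W k q f) \<in> vector_fields A" if "Y \<in> vector_fields A" for Y
    by (intro vector_fields_sum N(3) smooth that W)
  have Zl: "D Z (W k) p f = (\<Sum>l\<in>?K. Z p (F l) * D (W l) (W k) p f)" for k
  proof -
    have "D Z (W k) p = D (\<lambda>q f. \<Sum>l\<in>?K. Z q (F l) * W l q f) (W k) p"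
      by (rule connection_local_left[OF Z combination[OF Z] W N(1,2) expand[OF Z]])
    then show ?thesis by (simp add: connection_sum_left[OF N(3) smooth[OF Z] W W])
  qed
  have "D Z X p = D Z (\<lambda>q f. \<Sum>k\<in>?K. X q (F k) * W k q f) p"
    by (rule connection_local_right[OF X combination[OF X] Z N(1,2) expand[OF X]])
  then have "D Z X p f = (\<Sum>k\<in>?K. Z p (\<lambda>q. X q (F k)) * W k p f + X p (F k) * D Z (W k) p f)"
    by (simp add: connection_sum_right[OF N(3) smooth[OF X] W Z])
  also have "\<dots> = (\<Sum>k\<in>near_support p. Z p (\<lambda>q. X q (F k)) * W k p f + X p (F k) * D Z (W k) p f)"
    by (rule sum.mono_neutral_right[OF N(3) sub]) (auto simp: frame_zero connection_frame_zero_right[OF _ Z])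
  also have "\<dots> = (\<Sum>k\<in>near_support p. Z p (\<lambda>q. X q (F k)) * W k p f +
      X p (F k) * (\<Sum>l\<in>near_support p. Z p (F l) * D (W l) (W k) p f))"
  proof -
    have "(\<Sum>l\<in>?K. Z p (F l) * D (W l) (W k) p f) = (\<Sum>l\<in>near_support p. Z p (F l) * D (W l) (W k) p f)" for k
      by (rule sum.mono_neutral_right[OF N(3) sub]) (auto simp: connection_frame_zero_left[OF _ W])
    then show ?thesis by (simp add: Zl)
  qed
  finally show ?thesis .
qed

lemma frame_biform_smooth_on:
  assumes c: "(U, \<phi>) \<in> A" "(V, \<psi>) \<in> A"
    and w: "\<And>n. n \<in> V \<Longrightarrow> w n \<in> tangent_space A n"
    and v: "\<And>k. smooth_on (\<phi> ` U) (\<lambda>x. v (chart_inv (U, \<phi>) x) (F k))"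
    and gw: "\<And>X. X \<in> vector_fields A \<Longrightarrow> smooth_on (\<psi> ` V) (\<lambda>y. g (chart_inv (V, \<psi>) y) (X (chart_inv (V, \<psi>) y)) (w (chart_inv (V, \<psi>) y)))"
  shows "smooth_on (\<phi> ` U \<times> \<psi> ` V) (\<lambda>z. frame_biform (chart_inv (U, \<phi>) (fst z), chart_inv (V, \<psi>) (snd z))
    (v (chart_inv (U, \<phi>) (fst z))) (w (chart_inv (V, \<psi>) (snd z))))" (is "smooth_on _ ?\<omega>")
proof (rule smooth_on_local)
  let ?i = "chart_inv (U, \<phi>)" and ?j = "chart_inv (V, \<psi>)"
  fix z assume z: "z \<in> \<phi> ` U \<times> \<psi> ` V"
  then obtain n where n: "n \<in> V" "snd z = \<psi> n" by auto
  obtain N where N: "open N" "n \<in> N" "finite {k. \<exists>q\<in>N. W k q \<noteq> (\<lambda>f. 0)}"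
    using locally_finite by blast
  let ?K = "{k. \<exists>q\<in>N. W k q \<noteq> (\<lambda>f. 0)}"
  let ?S = "\<phi> ` U" and ?T = "\<psi> ` (V \<inter> N)"
  have S: "open ?S" by (rule chart_open_image[OF c(1)])
  have T: "open ?T" using chart_open[OF c(2)] N(1) by (intro chart_image_open[OF c(2)]) auto
  have sub: "?T \<subseteq> \<psi> ` V" by blast
  have ST: "open (?S \<times> ?T)" using S T by (rule open_Times)
  note fst = smooth_on_fst[OF basis S T] and snd = smooth_on_snd[OF basis S T]
  have sv: "smooth_on (?S \<times> ?T) (\<lambda>z. v (?i (fst z)) (F k))" for k by (rule fst[OF v])
  have sg: "smooth_on (?S \<times> ?T) (\<lambda>z. g (?j (snd z)) (X (?j (snd z))) (w (?j (snd z))))"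
    if "X \<in> vector_fields A" for X
    by (rule snd[OF smooth_on_subset[OF gw[OF that] sub]])
  have sF: "smooth_on (?S \<times> ?T) (\<lambda>z. F l (?i (fst z)))" for l
    using fst[OF smooth_functions_chart[OF c(1) F]] by simp
  have sF': "smooth_on (?S \<times> ?T) (\<lambda>z. F l (?j (snd z)))" for l
    using snd[OF smooth_on_subset[OF smooth_functions_chart[OF c(2) F] sub]] by simp
  have "smooth_on (?S \<times> ?T) (\<lambda>z. \<Sum>k\<in>?K. v (?i (fst z)) (F k) *
    (g (?j (snd z)) (W k (?j (snd z))) (w (?j (snd z))) + (\<Sum>l\<in>?K. (F l (?i (fst z)) - F l (?j (snd z))) *
      g (?j (snd z)) (D (W l) (W k) (?j (snd z))) (w (?j (snd z))))))"
    by (intro smooth_on_sum[OF ST] smooth_on_mult[OF ST] smooth_on_add[OF ST] smooth_on_diff[OF ST] sv sF sF'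
        sg[OF W] sg[OF connection_field[OF W W]])
  then have "smooth_on (?S \<times> ?T) ?\<omega>"
  proof (rule smooth_on_cong[OF ST, rotated])
    fix y assume "y \<in> ?S \<times> ?T"
    then obtain q where q: "q \<in> V" "q \<in> N" "snd y = \<psi> q" by auto
    have "?j (snd y) = q" using q by (simp add: chart_inv_chart[OF c(2)])
    then show "(\<Sum>k\<in>?K. v (?i (fst y)) (F k) *
      (g (?j (snd y)) (W k (?j (snd y))) (w (?j (snd y))) + (\<Sum>l\<in>?K. (F l (?i (fst y)) - F l (?j (snd y))) *
        g (?j (snd y)) (D (W l) (W k) (?j (snd y))) (w (?j (snd y)))))) = ?\<omega> y"
      using frame_biform_eq[OF N(3) near_support_subset[OF N(1) q(2)] w[OF q(1)]] by simp
  qed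
  moreover have "z \<in> ?S \<times> ?T" using z n N(2) by (cases z) auto
  ultimately show "\<exists>T. open T \<and> z \<in> T \<and> smooth_on T ?\<omega>" using ST by blast
qed

lemma global_biform_frame_biform: "global_biform A frame_biform"
proof -
  have "smooth_on (\<phi> ` U \<times> \<psi> ` V) (\<lambda>(x, y). let m = chart_inv (U, \<phi>) x; n = chart_inv (V, \<psi>) y in
      frame_biform (m, n) (coord_tangent A (U, \<phi>) m u) (coord_tangent A (V, \<psi>) n v))"
    if c: "(U, \<phi>) \<in> A" "(V, \<psi>) \<in> A" for U \<phi> V \<psi> u v
  proof -
    have "smooth_on (\<phi> ` U) (\<lambda>x. coord_tangent A (U, \<phi>) (chart_inv (U, \<phi>) x) u (F k))" for k
      by (rule smooth_on_cong[OF chart_open_image[OF c(1)] _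
            smooth_on_frechet_derivative[OF smooth_functions_chart[OF c(1) F], where v=u]])
        (simp add: coord_tangent_def F chart_chart_inv[OF c(1)])
    then show ?thesis unfolding Let_def case_prod_unfold
      by (rule frame_biform_smooth_on[OF c, where v="\<lambda>m. coord_tangent A (U, \<phi>) m u"
            and w="\<lambda>n. coord_tangent A (V, \<psi>) n v", rotated])
        (rule metric_smooth_field_coord[OF c(2)] coord_tangent_in_tangent_space[OF c(2)], assumption)+
  qed
  then show ?thesis unfolding global_biform_def using frame_biform_bilinear by blast
qed

text \<open>Needed before any derivative is computed: \<open>left_lift\<close> takes the default
  value 0 on functions that are not smooth on the product.\<close>

lemma frame_biform_apply_smooth:
  assumes X: "X \<in> vector_fields A" and Y: "Y \<in> vector_fields A"
  shows "biform_apply frame_biform X Y \<in> smooth_functions (prod_atlas A A)"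
proof -
  let ?\<omega> = "biform_apply frame_biform X Y"
  have "smooth_on (map_prod \<phi> \<psi> ` (U \<times> V)) (?\<omega> \<circ> chart_inv (U \<times> V, map_prod \<phi> \<psi>))"
    if c: "(U, \<phi>) \<in> A" "(V, \<psi>) \<in> A" for U \<phi> V \<psi>
  proof -
    have inj: "inj_on \<phi> U" "inj_on \<psi> V"
      using chart_inv_chart[OF c(1)] chart_inv_chart[OF c(2)] by (metis inj_onI)+
    have img: "map_prod \<phi> \<psi> ` (U \<times> V) = \<phi> ` U \<times> \<psi> ` V" by (rule map_prod_surj_on[OF refl refl])
    have o: "open (\<phi> ` U \<times> \<psi> ` V)" by (intro open_Times chart_open_image c)
    have "smooth_on (\<phi> ` U) (\<lambda>x. X (chart_inv (U, \<phi>) x) (F k))" for k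
      using smooth_functions_chart[OF c(1) vector_field_smooth[OF X F]] by (simp add: o_def)
    moreover have "smooth_on (\<psi> ` V) (\<lambda>y. g (chart_inv (V, \<psi>) y) (Z (chart_inv (V, \<psi>) y)) (Y (chart_inv (V, \<psi>) y)))"
      if "Z \<in> vector_fields A" for Z
      using smooth_functions_chart[OF c(2) metric_smooth_fields[OF that Y]] by (simp add: o_def)
    ultimately have "smooth_on (\<phi> ` U \<times> \<psi> ` V) (\<lambda>z. frame_biform (chart_inv (U, \<phi>) (fst z), chart_inv (V, \<psi>) (snd z))
        (X (chart_inv (U, \<phi>) (fst z))) (Y (chart_inv (V, \<psi>) (snd z))))"
      by (rule frame_biform_smooth_on[OF c vector_field_tangent[OF Y]])
    then show ?thesis unfolding img
      by (rule smooth_on_cong[OF o, rotated])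
        (auto simp: biform_apply_def chart_inv_prod[OF inj] chart_inv_chart[OF c(1)] chart_inv_chart[OF c(2)])
  qed
  then show ?thesis unfolding smooth_functions_def prod_atlas_def by blast
qed

text \<open>With the right point frozen at \<open>p\<close>, the index set is constant and the
  values of \<open>g\<close> are constants, so what \<open>Z p\<close> differentiates is a finite
  sum of products of \<open>X q (F k)\<close> with the affine expression \<open>?e k\<close> in the
  functions \<open>F l\<close>.\<close>

lemma left_derivative_frame_biform:
  assumes X: "X \<in> vector_fields A" and Y: "Y \<in> vector_fields A" and Z: "Z \<in> vector_fields A"
  shows "diag_pullback (lie_derivative (left_lift A Z) (biform_apply frame_biform X Y)) p = g p (D Z X p) (Y p)"
proof -
  let ?S = "near_support p"
  let ?a = "\<lambda>k. g p (W k p) (Y p)" and ?d = "\<lambda>k l. g p (D (W l) (W k) p) (Y p)"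
  let ?e = "\<lambda>k q. ?a k + (\<Sum>l\<in>?S. ?d k l * (F l q - F l p))"
  have Zp: "Z p \<in> tangent_space A p" and Yp: "Y p \<in> tangent_space A p"
    by (intro vector_field_tangent X Y Z)+
  have s1: "(\<lambda>q. X q (F k)) \<in> smooth_functions A" for k by (rule vector_field_smooth[OF X F])
  have s2: "(\<lambda>q. ?d k l * (F l q - F l p)) \<in> smooth_functions A" for k l
    by (intro smooth_functions_mult smooth_functions_diff smooth_functions_const F)
  have s3: "(\<lambda>q. \<Sum>l\<in>?S. ?d k l * (F l q - F l p)) \<in> smooth_functions A" for k
    by (intro smooth_functions_sum s2)
  have s4: "?e k \<in> smooth_functions A" for k
    by (intro smooth_functions_add smooth_functions_const s3)
  have Z2: "Z p (\<lambda>q. ?d k l * (F l q - F l p)) = Z p (F l) * ?d k l" for k l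
    using tangent_linear[OF Zp F[of l] smooth_functions_const[of 1], of "?d k l" "- ?d k l * F l p"]
    by (simp add: tangent_const[OF Zp] algebra_simps)
  have Z4: "Z p (?e k) = (\<Sum>l\<in>?S. Z p (F l) * ?d k l)" for k
    by (simp add: tangent_add[OF Zp smooth_functions_const s3] tangent_const[OF Zp] tangent_sum[OF Zp s2] Z2)
  have "diag_pullback (lie_derivative (left_lift A Z) (biform_apply frame_biform X Y)) p =
      Z p (\<lambda>q. \<Sum>k\<in>?S. X q (F k) * ?e k q)"
    using frame_biform_apply_smooth[OF X Y]
    by (simp add: diag_pullback_def lie_derivative_def left_lift_def biform_apply_def frame_biform_def mult.commute)
  also have "\<dots> = (\<Sum>k\<in>?S. Z p (\<lambda>q. X q (F k) * ?e k q))"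
    by (intro tangent_sum[OF Zp] smooth_functions_mult s1 s4)
  \<comment> \<open>Here \<open>?e k\<close> at \<open>p\<close> has become \<open>?a k\<close>,
    because the differences \<open>F l q - F l p\<close> vanish at \<open>q = p\<close>.\<close>
  also have "\<dots> = (\<Sum>k\<in>?S. X p (F k) * Z p (?e k) + ?a k * Z p (\<lambda>q. X q (F k)))"
    by (simp add: tangent_mult[OF Zp s1 s4])
  also have "\<dots> = (\<Sum>k\<in>?S. Z p (\<lambda>q. X q (F k)) * ?a k + X p (F k) * (\<Sum>l\<in>?S. Z p (F l) * ?d k l))"
    unfolding Z4 by (intro sum.cong refl) (simp add: algebra_simps)
  also have "\<dots> = g p (D Z X p) (Y p)"
  proof -
    let ?V = "\<lambda>k f. \<Sum>l\<in>?S. Z p (F l) * D (W l) (W k) p f"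
    have V: "?V k \<in> tangent_space A p" for k
      by (intro tangent_space_sum connection_tangent W)
    have gV: "g p (?V k) (Y p) = (\<Sum>l\<in>?S. Z p (F l) * ?d k l)" for k
      by (intro metric_sum_left Yp connection_tangent W)
    \<comment> \<open>The coefficient 1 brings the sum into the form required by
      \<open>metric_sum_left\<close>.\<close>
    have "D Z X p = (\<lambda>f. \<Sum>k\<in>?S. 1 * (Z p (\<lambda>q. X q (F k)) * W k p f + X p (F k) * ?V k f))"
      using connection_in_frame[OF X Z, of p] by (simp add: fun_eq_iff)
    then have "g p (D Z X p) (Y p) =
        g p (\<lambda>f. \<Sum>k\<in>?S. 1 * (Z p (\<lambda>q. X q (F k)) * W k p f + X p (F k) * ?V k f)) (Y p)"
      by (rule arg_cong)
    also have "\<dots> = (\<Sum>k\<in>?S. 1 * g p (\<lambda>f. Z p (\<lambda>q. X q (F k)) * W k p f + X p (F k) * ?V k f) (Y p))"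
      by (intro metric_sum_left Yp tangent_space_combine V vector_field_tangent[OF W])
    also have "\<dots> = (\<Sum>k\<in>?S. Z p (\<lambda>q. X q (F k)) * ?a k + X p (F k) * (\<Sum>l\<in>?S. Z p (F l) * ?d k l))"
      by (simp add: bilinear_between_left_combine[OF metric_bilinear vector_field_tangent[OF W] V Yp] gV)
    finally show ?thesis by simp
  qed
  finally show ?thesis .
qed

text \<open>Freezing the frame coefficients of \<open>w\<close> at \<open>p\<close> gives a global
  field. It bridges the nondegeneracy of \<open>g\<close>, tested on tangent vectors, and the
  condition in \<open>induced_connection\<close>, tested on vector fields.\<close>

lemma vector_field_through:
  assumes w: "w \<in> tangent_space A p"
  shows "\<exists>Y\<in>vector_fields A. Y p = w"
proof -
  let ?Y = "\<lambda>q f. \<Sum>k\<in>near_support p. w (F k) * W k q f"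
  have "?Y \<in> vector_fields A"
    by (intro vector_fields_sum finite_near_support smooth_functions_const W)
  moreover have "?Y p = w"
    by (rule frame_expand[OF w finite_near_support, symmetric]) (erule contrapos_np, rule frame_zero)
  ultimately show ?thesis by (rule rev_bexI[of ?Y])
qed

text \<open>The definite description requires uniqueness as well: two candidates pair equally with
  every field, hence with every tangent vector at \<open>p\<close>, and nondegeneracy makes their
  difference vanish.\<close>

lemma induced_connection_frame_biform:
  assumes X: "X \<in> vector_fields A" and Z: "Z \<in> vector_fields A"
  shows "induced_connection A frame_biform Z X = D Z X"
  unfolding induced_connection_def
proof (rule the_equality)
  show "D Z X \<in> vector_fields A \<and> (\<forall>Y\<in>vector_fields A. (\<lambda>m. induced_metric frame_biform m (D Z X m) (Y m)) =
        diag_pullback (lie_derivative (left_lift A Z) (biform_apply frame_biform X Y)))"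
  proof (intro conjI ballI ext)
    fix Y p assume Y: "Y \<in> vector_fields A"
    show "induced_metric frame_biform p (D Z X p) (Y p) =
        diag_pullback (lie_derivative (left_lift A Z) (biform_apply frame_biform X Y)) p"
      unfolding left_derivative_frame_biform[OF X Y Z]
      by (rule induced_metric_frame_biform[OF connection_tangent[OF Z X] vector_field_tangent[OF Y]])
  qed (rule connection_field[OF Z X])
next
  fix W' assume W': "W' \<in> vector_fields A \<and> (\<forall>Y\<in>vector_fields A. (\<lambda>m. induced_metric frame_biform m (W' m) (Y m)) =
        diag_pullback (lie_derivative (left_lift A Z) (biform_apply frame_biform X Y)))"
  show "W' = D Z X"
  proof
    fix p
    have t: "W' p \<in> tangent_space A p" "D Z X p \<in> tangent_space A p"
      using W' connection_tangent[OF Z X] vector_field_tangent by blast+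
    have eq: "g p (W' p) w = g p (D Z X p) w" if w: "w \<in> tangent_space A p" for w
    proof -
      obtain Y where Y: "Y \<in> vector_fields A" "Y p = w" using vector_field_through[OF w] by blast
      have "induced_metric frame_biform p (W' p) (Y p) = g p (D Z X p) (Y p)"
        using fun_cong[OF bspec[OF conjunct2[OF W'] Y(1)], of p]
        unfolding left_derivative_frame_biform[OF X Y(1) Z] .
      then show ?thesis using Y(2) induced_metric_frame_biform[OF t(1) w] by simp
    qed
    have "(\<lambda>f. 1 * W' p f + (- 1) * D Z X p f) = (\<lambda>f. 0)"
    proof (rule metric_nondegenerate)
      show "(\<lambda>f. 1 * W' p f + (- 1) * D Z X p f) \<in> tangent_space A p" by (rule tangent_space_combine[OF t])
      fix w assume w: "w \<in> tangent_space A p"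
      show "g p (\<lambda>f. 1 * W' p f + (- 1) * D Z X p f) w = 0"
        unfolding bilinear_between_left_combine[OF metric_bilinear t w] using eq[OF w] by simp
    qed
    then show "W' p = D Z X p" by (simp add: fun_eq_iff)
  qed
qed

lemma contrast_biform_frame_biform: "contrast_biform A frame_biform"
proof -
  note eq = induced_metric_frame_biform
  have "bilinear_between (tangent_space A p) (tangent_space A p) (induced_metric frame_biform p)" for p
    unfolding induced_metric_def by (rule frame_biform_bilinear)
  moreover have "v = (\<lambda>f. 0)"
    if v: "v \<in> tangent_space A p" "\<forall>w\<in>tangent_space A p. induced_metric frame_biform p v w = 0" for p v
    using v(2) by (intro metric_nondegenerate[OF v(1)]) (simp add: eq[OF v(1)])
  moreover have "smooth_on (\<phi> ` U) (\<lambda>x. let p = chart_inv (U, \<phi>) x in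
      induced_metric frame_biform p (coord_tangent A (U, \<phi>) p u) (coord_tangent A (U, \<phi>) p u'))"
    if c: "(U, \<phi>) \<in> A" for U \<phi> u u'
    by (rule smooth_on_cong[OF chart_open_image[OF c] _ metric_smooth_coord[OF c]])
      (simp add: Let_def eq coord_tangent_in_tangent_space[OF c] chart_inv_in[OF c])
  ultimately have "pseudo_riemannian_metric A (induced_metric frame_biform)"
    unfolding pseudo_riemannian_metric_def by (auto simp: eq metric_sym)
  then show ?thesis by (simp add: contrast_biform_def global_biform_frame_biform)
qed

lemma integrates_frame_biform: "integrates A frame_biform g D"
  by (simp add: integrates_def induced_metric_frame_biform induced_connection_frame_biform)

end

theorem proposition2p2:
  fixes A :: "('m::{t2_space, second_countable_topology}, 'e::real_inner) chart set"
    and g :: "'m \<Rightarrow> 'm tvec \<Rightarrow> 'm tvec \<Rightarrow> real"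
    and D :: "'m vfield \<Rightarrow> 'm vfield \<Rightarrow> 'm vfield"
  assumes "lauritzen_manifold A g D"
  shows "\<exists>\<omega> :: 'm biform. contrast_biform A \<omega> \<and> integrates A \<omega> g D"
proof -
  have M: "smooth_manifold A" "pseudo_riemannian_metric A g" "affine_connection A D"
    using assms unfolding lauritzen_manifold_def by blast+
  have "\<exists>C::'e set. finite C \<and> span C = UNIV"
    using M(1) unfolding smooth_manifold_def by (elim conjE)
  then obtain C :: "'e set" where "finite C" "span C = UNIV" by (elim exE conjE)
  then obtain B :: "'e set" where B: "expansion_basis B"
    using expansion_basis_exists[of C] by blast
  interpret atlas_connection A B g D
    by unfold_locales (fact M B)+
  obtain F :: "nat \<times> 'e \<Rightarrow> 'm \<Rightarrow> real" and W where FW: "\<forall>k. F k \<in> smooth_functions A" "\<forall>k. W k \<in> vector_fields A"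
    "\<forall>p. \<exists>N. open N \<and> p \<in> N \<and> finite {k. \<exists>q\<in>N. W k q \<noteq> (\<lambda>f. 0)}"
    "\<forall>p. \<forall>v\<in>tangent_space A p. v = (\<lambda>f. \<Sum>k | W k p \<noteq> (\<lambda>f. 0). v (F k) * W k p f)"
    using smooth_frame_exists by (elim exE conjE)
  interpret atlas_frame A B g D F W
  proof
    show "F k \<in> smooth_functions A" "W k \<in> vector_fields A" for k by (rule FW[THEN spec])+
    show "\<exists>N. open N \<and> p \<in> N \<and> finite {k. \<exists>q\<in>N. W k q \<noteq> (\<lambda>f. 0)}" for p using FW(3) by (rule spec)
    show "v = (\<lambda>f. \<Sum>k | W k p \<noteq> (\<lambda>f. 0). v (F k) * W k p f)" if "v \<in> tangent_space A p" for v p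
      using FW(4)[THEN spec, THEN bspec, OF that] .
  qed
  show ?thesis using contrast_biform_frame_biform integrates_frame_biform by blast
qed

end
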